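(* Let $y$ be a random element of $D([0,1],C[0,T])$ satisfying (C1)–(C4) of the context, and write $y(t)=y(\cdot,t)$. For each $a\in L_2$ the process $(y(t),a)$, $t\in[0,T]$, is a continuous square integrable $(\mathcal{F}_t)$-martingale with quadratic variation $$[(y(\cdot),a)]_t=\int_0^t\|\mathrm{pr}_{y(s)}a\|_{L_2}^2\,ds.$$
   Context: Fix $T>0$ and let $\lambda$ be Lebesgue measure on $[0,1]$; $L_2=L_2([0,1],\lambda)$ with norm $\|\cdot\|_{L_2}$ and inner product $(\cdot,\cdot)$. $D([0,1],C[0,T])$ is the Skorokhod space of càdlàg functions from $[0,1]$ into $C[0,T]$ with the uniform distance. A random element $y=\{y(u,t),\ u\in[0,1],\ t\in[0,T]\}$ of $D([0,1],C[0,T])$ is required to satisfy: (C1) for all $u\in[0,1]$ the process $y(u,\cdot)$ is a continuous square integrable martingale with respect to the filtration $\mathcal{F}_t=\sigma(y(v,s),\ v\in[0,1],\ s\le t)$, $t\in[0,T]$; (C2) $y(u,0)=u$ for all $u\in[0,1]$; (C3) $y(u,t)\le y(v,t)$ for all $u<v$ in $[0,1]$ and $t\in[0,T]$; (C4) for all $u,v\in[0,1]$ the joint quadratic variation is $[y(u,\cdot),y(v,\cdot)]_t=\int_0^t\frac{\mathbb{I}_{\{\tau_{u,v}\le s\}}}{m(u,s)}ds$, where $m(u,t)=\lambda\{v:\ \exists s\le t,\ y(v,s)=y(u,s)\}$ and $\tau_{u,v}=\inf\{t:\ y(u,t)=y(v,t)\}\wedge T$. For $b\in L_2$, $\mathrm{pr}_b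 a$ denotes the orthogonal projection in $L_2$ of $a$ onto the subspace of $\sigma(b)$-measurable functions. Almost surely, for all $t\in(0,T]$ the function $y(\cdot,t)$ is a step function with finitely many jumps, and $y(u,t)=y(v,t)$ implies $y(u,s)=y(v,s)$ for all $s\in[t,T]$; by convention this is assumed to hold for every $\omega$. *)

theory Defs
  imports "HOL-Probability.Probability"
begin

section \<open>The Skorokhod space of right-continuous functions with left limits into C[0,T]\<close>

text \<open>C[0,T] with the uniform distance. Its elements are extensional on [0,T].\<close>

definition C0T :: "real \<Rightarrow> (real \<Rightarrow> real) metric" where
  "C0T T = cfunspace (top_of_set {0..T}) euclidean_metric"

definition cadlag_C :: "real \<Rightarrow> (real \<Rightarrow> real \<Rightarrow> real) set" where
  "cadlag_C T = {x \<in> {0..1} \<rightarrow>\<^sub>E mspace (C0T T).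
     (\<forall>u. 0 \<le> u \<and> u < 1 \<longrightarrow> limitin (mtopology_of (C0T T)) x (x u) (at_right u)) \<and>
     (\<forall>u. 0 < u \<and> u \<le> 1 \<longrightarrow> (\<exists>l. limitin (mtopology_of (C0T T)) x l (at_left u)))}"

text \<open>Increasing bijections of [0,1] are automatically homeomorphisms.\<close>

definition time_change :: "(real \<Rightarrow> real) \<Rightarrow> bool" where
  "time_change h \<longleftrightarrow> strict_mono_on {0..1} h \<and> bij_betw h {0..1} {0..1}"

definition skorokhod_dist ::
    "real \<Rightarrow> (real \<Rightarrow> real \<Rightarrow> real) \<Rightarrow> (real \<Rightarrow> real \<Rightarrow> real) \<Rightarrow> real" where
  "skorokhod_dist T x z = Inf {e. 0 \<le> e \<and> (\<exists>h. time_change h \<and>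
     (\<forall>u\<in>{0..1}. \<bar>h u - u\<bar> \<le> e \<and> mdist (C0T T) (x u) (z (h u)) \<le> e))}"

text \<open>The Borel sigma-algebra of the Skorokhod topology.\<close>

definition skorokhod_space :: "real \<Rightarrow> (real \<Rightarrow> real \<Rightarrow> real) measure" where
  "skorokhod_space T = sigma (cadlag_C T)
     {U. U \<subseteq> cadlag_C T \<and>
         (\<forall>x\<in>U. \<exists>e>0. \<forall>z\<in>cadlag_C T. skorokhod_dist T x z < e \<longrightarrow> z \<in> U)}"

text \<open>Random fields are written \<open>y u t \<omega>\<close>; only the values for u in [0,1] and t in [0,T]
  are relevant.\<close>

definition random_element_D :: "'w measure \<Rightarrow> real \<Rightarrow> (real \<Rightarrow> real \<Rightarrow> 'w \<Rightarrow> real) \<Rightarrow> bool" where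
  "random_element_D M T y \<longleftrightarrow>
     (\<lambda>\<omega>. \<lambda>u\<in>{0..1}. \<lambda>t\<in>{0..T}. y u t \<omega>) \<in> M \<rightarrow>\<^sub>M skorokhod_space T"

section \<open>Martingales and quadratic variation\<close>

text \<open>The filtration is not augmented by null sets.\<close>

definition natural_filtration ::
    "'w measure \<Rightarrow> real \<Rightarrow> (real \<Rightarrow> real \<Rightarrow> 'w \<Rightarrow> real) \<Rightarrow> real \<Rightarrow> 'w measure" where
  "natural_filtration M T y t = sigma (space M)
     {y v s -` B \<inter> space M | v s B. v \<in> {0..1} \<and> s \<in> {0..T} \<and> s \<le> t \<and> B \<in> sets borel}"

definition martingale_on ::
    "'w measure \<Rightarrow> (real \<Rightarrow> 'w measure) \<Rightarrow> real \<Rightarrow> (real \<Rightarrow> 'w \<Rightarrow> real) \<Rightarrow> bool" where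
  "martingale_on M F T X \<longleftrightarrow>
     (\<forall>t\<in>{0..T}. subalgebra M (F t) \<and> X t \<in> borel_measurable (F t) \<and> integrable M (X t)) \<and>
     (\<forall>s\<in>{0..T}. \<forall>t\<in>{s..T}. AE \<omega> in M. real_cond_exp M (F s) (X t) \<omega> = X s \<omega>)"

definition cont_sq_int_martingale ::
    "'w measure \<Rightarrow> (real \<Rightarrow> 'w measure) \<Rightarrow> real \<Rightarrow> (real \<Rightarrow> 'w \<Rightarrow> real) \<Rightarrow> bool" where
  "cont_sq_int_martingale M F T X \<longleftrightarrow> martingale_on M F T X \<and>
     (\<forall>t\<in>{0..T}. integrable M (\<lambda>\<omega>. (X t \<omega>)\<^sup>2)) \<and>
     (\<forall>\<omega>\<in>space M. continuous_on {0..T} (\<lambda>t. X t \<omega>))"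

definition finite_variation :: "real \<Rightarrow> (real \<Rightarrow> real) \<Rightarrow> bool" where
  "finite_variation T f \<longleftrightarrow> (\<exists>V. \<forall>(n::nat) p. mono_on {..n} p \<and> p ` {..n} \<subseteq> {0..T} \<longrightarrow>
     (\<Sum>i<n. \<bar>f (p (Suc i)) - f (p i)\<bar>) \<le> V)"

text \<open>The joint quadratic variation \<open>[X, Y]\<close> of two continuous square integrable martingales is
  the process A, unique up to indistinguishability, that is adapted, continuous and of finite
  variation, starts at 0 and makes \<open>X Y - A\<close> a martingale.\<close>

definition joint_qv :: "'w measure \<Rightarrow> (real \<Rightarrow> 'w measure) \<Rightarrow> real \<Rightarrow>
    (real \<Rightarrow> 'w \<Rightarrow> real) \<Rightarrow> (real \<Rightarrow> 'w \<Rightarrow> real) \<Rightarrow> (real \<Rightarrow> 'w \<Rightarrow> real) \<Rightarrow> bool" where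
  "joint_qv M F T X Y A \<longleftrightarrow>
     (\<forall>t\<in>{0..T}. A t \<in> borel_measurable (F t)) \<and>
     (AE \<omega> in M. A 0 \<omega> = 0 \<and> continuous_on {0..T} (\<lambda>t. A t \<omega>) \<and>
       finite_variation T (\<lambda>t. A t \<omega>)) \<and>
     martingale_on M F T (\<lambda>t \<omega>. X t \<omega> * Y t \<omega> - A t \<omega>)"

text \<open>\<open>[X, Y]\<^sub>t = Q\<^sub>t\<close> for all t in [0,T], almost surely. The values of Q are extended reals so
  that the equation includes the finiteness of Q.\<close>

definition joint_qv_eq :: "'w measure \<Rightarrow> (real \<Rightarrow> 'w measure) \<Rightarrow> real \<Rightarrow>
    (real \<Rightarrow> 'w \<Rightarrow> real) \<Rightarrow> (real \<Rightarrow> 'w \<Rightarrow> real) \<Rightarrow> (real \<Rightarrow> 'w \<Rightarrow> ereal) \<Rightarrow> bool" where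
  "joint_qv_eq M F T X Y Q \<longleftrightarrow>
     (\<exists>A. joint_qv M F T X Y A \<and> (AE \<omega> in M. \<forall>t\<in>{0..T}. ereal (A t \<omega>) = Q t \<omega>))"

section \<open>Conditions (C1)--(C4)\<close>

definition meeting_time :: "real \<Rightarrow> (real \<Rightarrow> real \<Rightarrow> 'w \<Rightarrow> real) \<Rightarrow> real \<Rightarrow> real \<Rightarrow> 'w \<Rightarrow> real" where
  "meeting_time T y u v \<omega> = Inf (insert T {t \<in> {0..T}. y u t \<omega> = y v t \<omega>})"

definition cluster_mass :: "(real \<Rightarrow> real \<Rightarrow> 'w \<Rightarrow> real) \<Rightarrow> real \<Rightarrow> real \<Rightarrow> 'w \<Rightarrow> ennreal" where
  "cluster_mass y u t \<omega> =
     emeasure lebesgue {v \<in> {0..1}. \<exists>s\<in>{0..t}. y v s \<omega> = y u s \<omega>}"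

text \<open>In (C4) the integrand is taken in \<open>ennreal\<close>, where 1/0 is infinite and 0/0 is 0.\<close>

definition cond_C1_C4 :: "'w measure \<Rightarrow> real \<Rightarrow> (real \<Rightarrow> real \<Rightarrow> 'w \<Rightarrow> real) \<Rightarrow> bool" where
  "cond_C1_C4 M T y \<longleftrightarrow>
     (\<forall>u\<in>{0..1}. cont_sq_int_martingale M (natural_filtration M T y) T (y u)) \<and>
     (AE \<omega> in M. \<forall>u\<in>{0..1}. y u 0 \<omega> = u) \<and>
     (AE \<omega> in M. \<forall>u\<in>{0..1}. \<forall>v\<in>{0..1}. u < v \<longrightarrow> (\<forall>t\<in>{0..T}. y u t \<omega> \<le> y v t \<omega>)) \<and>
     (\<forall>u\<in>{0..1}. \<forall>v\<in>{0..1}. joint_qv_eq M (natural_filtration M T y) T (y u) (y v)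
        (\<lambda>t \<omega>. enn2ereal (\<integral>\<^sup>+ s\<in>{0..t}.
           (indicator {meeting_time T y u v \<omega>..} s / cluster_mass y u s \<omega>) \<partial>lborel)))"

section \<open>The pathwise convention\<close>

definition step_function :: "(real \<Rightarrow> real) \<Rightarrow> bool" where
  "step_function f \<longleftrightarrow> (\<exists>P. finite P \<and>
     (\<forall>u\<in>{0..1}. \<forall>v\<in>{0..1}. u \<le> v \<and> {u..v} \<inter> P = {} \<longrightarrow> f u = f v))"

definition pathwise_convention ::
    "'w measure \<Rightarrow> real \<Rightarrow> (real \<Rightarrow> real \<Rightarrow> 'w \<Rightarrow> real) \<Rightarrow> bool" where
  "pathwise_convention M T y \<longleftrightarrow> (\<forall>\<omega>\<in>space M.
     (\<forall>t\<in>{0<..T}. step_function (\<lambda>u. y u t \<omega>)) \<and>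
     (\<forall>u\<in>{0..1}. \<forall>v\<in>{0..1}. \<forall>t\<in>{0<..T}. y u t \<omega> = y v t \<omega> \<longrightarrow>
        (\<forall>s\<in>{t..T}. y u s \<omega> = y v s \<omega>)))"

section \<open>The space \<open>L\<^sub>2\<close> and projections\<close>

text \<open>Elements of \<open>L\<^sub>2\<close> are given by representatives, so the projection below is determined
  up to equality almost everywhere.\<close>

definition L2_01 :: "(real \<Rightarrow> real) set" where
  "L2_01 = {f \<in> borel_measurable (lebesgue_on {0..1}).
     integrable (lebesgue_on {0..1}) (\<lambda>u. (f u)\<^sup>2)}"

definition inner_L2 :: "(real \<Rightarrow> real) \<Rightarrow> (real \<Rightarrow> real) \<Rightarrow> real" where
  "inner_L2 f g = (LINT u|lebesgue_on {0..1}. f u * g u)"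

definition norm_L2 :: "(real \<Rightarrow> real) \<Rightarrow> real" where
  "norm_L2 f = sqrt (inner_L2 f f)"

definition sigma_meas_L2 :: "(real \<Rightarrow> real) \<Rightarrow> (real \<Rightarrow> real) set" where
  "sigma_meas_L2 b = L2_01 \<inter> borel_measurable (vimage_algebra {0..1} b borel)"

definition pr_L2 :: "(real \<Rightarrow> real) \<Rightarrow> (real \<Rightarrow> real) \<Rightarrow> (real \<Rightarrow> real)" where
  "pr_L2 b a = (SOME g. g \<in> sigma_meas_L2 b \<and>
     (\<forall>h\<in>sigma_meas_L2 b. inner_L2 (\<lambda>u. a u - g u) h = 0))"

end

theory Submission
  imports Defs
begin

text \<open>
  Write \<open>a\<close> for the fixed square integrable function. The pairing \<open>(y(t), a)\<close> is the mixture of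
  the martingales \<open>y(u, \<cdot>)\<close> with weights \<open>a(u) du\<close>, and its square is the mixture of the products
  \<open>y(u, \<cdot>) y(v, \<cdot>)\<close> with weights \<open>a(u) a(v) du dv\<close>. By Fubini, an integrable mixture of martingales
  is a martingale (\<open>martingale_on_mixture\<close>). So the pairing is a martingale, and its square becomes
  one after subtracting the mixture of the joint quadratic variations,
  \<open>\<integral>\<integral> a(u) a(v) \<integral>\<^sub>0\<^sup>t k\<^sub>s(u, v) ds du dv\<close>. Here \<open>k\<^sub>s(u, v)\<close> is the density in (C4). Since
  particles never separate after meeting at a positive time, and start at different points, \<open>k\<^sub>s(u, v)\<close>
  is \<open>1 / m(u, s)\<close> if \<open>y(u, s) = y(v, s)\<close> and \<open>0\<close> otherwise, where \<open>m(u, s)\<close> is the length of the level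
  set of \<open>y(s)\<close> through \<open>u\<close> (\<open>cluster_kernel_eq\<close>).

  For a step function \<open>b\<close>, the integral operator with this kernel averages over the level sets of
  \<open>b\<close>, that is, it is the projection onto the \<open>\<sigma>(b)\<close>-measurable functions
  (\<open>level_average_projection\<close>). Therefore \<open>\<integral>\<integral> a(u) a(v) k\<^sub>s(u, v) du dv = (a, pr a) = \<parallel>pr a\<parallel>\<^sup>2\<close>, with the
  projection taken at \<open>b = y(s)\<close>, and exchanging the order of integration gives the formula for the
  quadratic variation. The same identity for \<open>\<bar>a\<bar>\<close>, together with \<open>\<parallel>pr \<bar>a\<bar>\<parallel> \<le> \<parallel>a\<parallel>\<close>, yields the
  absolute integrability that Fubini requires, although \<open>1 / m\<close> is unbounded near time \<open>0\<close>
  (\<open>nn_integral_level_kernel_le\<close>). The products are dominated through the monotonicity (C3):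
  \<open>\<bar>y(u, t)\<bar> \<le> \<bar>y(0, t)\<bar> + \<bar>y(1, t)\<bar>\<close>.

  The filtration is not completed, so adaptedness has to come from measurability for every \<open>\<omega>\<close>. It
  rests on the joint measurability of \<open>(u, s, \<omega>) \<mapsto> y(u, s, \<omega>)\<close> for \<open>s \<le> t\<close> with respect to the
  \<open>\<sigma>\<close>-algebra at time \<open>t\<close> (\<open>measurable_random_field\<close>).
\<close>

abbreviation unit_lebesgue :: "real measure" where
  "unit_lebesgue \<equiv> lebesgue_on {0..1}"

lemma finite_measure_unit: "finite_measure unit_lebesgue"
  by (intro finite_measure_lebesgue_on) simp

lemma unit_borel: "f \<in> borel_measurable borel \<Longrightarrow> f \<in> borel_measurable unit_lebesgue"
  by (simp add: measurable_completion measurable_restrict_space1)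

lemma AE_unit_less_one: "AE u in unit_lebesgue. u < 1"
proof -
  have "AE u in lebesgue. u \<noteq> (1::real)"
    by (rule AE_completion[OF AE_lborel_singleton])
  then show ?thesis by (subst AE_restrict_space_iff) (auto elim: eventually_mono)
qed

section \<open>Paths in the Skorokhod space\<close>

lemma mdist_C0T_less:
  assumes "0 \<le> T" "f \<in> mspace (C0T T)" "g \<in> mspace (C0T T)" "mdist (C0T T) f g < e"
    and "t \<in> {0..T}"
  shows "\<bar>f t - g t\<bar> < e"
proof -
  have "mdist (C0T T) f g \<le> mdist (C0T T) f g \<longleftrightarrow>
      (\<forall>x\<in>topspace (top_of_set {0..T}). mdist euclidean_metric (f x) (g x) \<le> mdist (C0T T) f g)"
    using assms unfolding C0T_def by (intro cfunspace_mdist_le) auto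
  then have "dist (f t) (g t) \<le> mdist (C0T T) f g"
    using assms(5) by auto
  with assms(4) show ?thesis by (simp add: dist_real_def)
qed

lemma limitin_C0T_uniform:
  assumes "0 \<le> T" "limitin (mtopology_of (C0T T)) x l F" "0 < e"
  shows "\<forall>\<^sub>F u in F. \<forall>t\<in>{0..T}. \<bar>x u t - l t\<bar> < e"
proof -
  interpret Metric_space "mspace (C0T T)" "mdist (C0T T)" by simp
  have l: "l \<in> mspace (C0T T)"
    and ev: "\<forall>\<^sub>F u in F. x u \<in> mspace (C0T T) \<and> mdist (C0T T) (x u) l < e"
    using assms(2,3) unfolding mtopology_of_def limitin_metric by auto
  from ev show ?thesis
    by eventually_elim (use mdist_C0T_less[OF assms(1) _ l] in blast)
qed

lemma C0T_bounded:
  assumes "0 \<le> T" "f \<in> mspace (C0T T)"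
  obtains C where "\<And>t. t \<in> {0..T} \<Longrightarrow> \<bar>f t\<bar> \<le> C"
proof -
  have "continuous_on {0..T} f"
    using assms by (simp add: C0T_def mtopology_of_def)
  then have "bounded (f ` {0..T})"
    by (intro compact_imp_bounded compact_continuous_image) auto
  then obtain C where "\<forall>z\<in>f ` {0..T}. norm z \<le> C" unfolding bounded_iff by blast
  then have "\<bar>f t\<bar> \<le> C" if "t \<in> {0..T}" for t using that by auto
  then show thesis by (rule that)
qed

lemma cadlag_C_continuous:
  assumes "x \<in> cadlag_C T" "u \<in> {0..1}"
  shows "continuous_on {0..T} (x u)"
proof -
  have "x u \<in> mspace (C0T T)" using assms by (auto simp: cadlag_C_def)
  then show ?thesis by (simp add: C0T_def)
qed

lemma cadlag_C_right:
  assumes "x \<in> cadlag_C T" "0 \<le> T" "0 \<le> u" "u < 1" "0 < e"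
  shows "\<forall>\<^sub>F v in at_right u. \<forall>t\<in>{0..T}. \<bar>x v t - x u t\<bar> < e"
  using assms by (intro limitin_C0T_uniform) (auto simp: cadlag_C_def)

text \<open>Compactness of \<open>[0,1]\<close>: the one-sided limits bound the path near each point, and Bolzano's
  bisection principle glues the local bounds together.\<close>

lemma cadlag_C_bounded:
  assumes x: "x \<in> cadlag_C T" and T: "0 \<le> T"
  obtains C where "\<And>u t. u \<in> {0..1} \<Longrightarrow> t \<in> {0..T} \<Longrightarrow> \<bar>x u t\<bar> \<le> C"
proof -
  define bd where "bd S \<longleftrightarrow> (\<exists>C. \<forall>u\<in>S \<inter> {0..1}. \<forall>t\<in>{0..T}. \<bar>x u t\<bar> \<le> C)" for S
  have bd_Un: "bd (R \<union> S)" if "bd R" "bd S" for R S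
  proof -
    obtain C D where "\<forall>u\<in>R \<inter> {0..1}. \<forall>t\<in>{0..T}. \<bar>x u t\<bar> \<le> C" "\<forall>u\<in>S \<inter> {0..1}. \<forall>t\<in>{0..T}. \<bar>x u t\<bar> \<le> D"
      using \<open>bd R\<close> \<open>bd S\<close> unfolding bd_def by blast
    then show ?thesis unfolding bd_def
      by (intro exI[of _ "max C D"]) (auto simp: le_max_iff_disj)
  qed
  have bd_mono: "bd R" if "bd S" "R \<subseteq> S" for R S
    using that unfolding bd_def by blast
  have space: "x u \<in> mspace (C0T T)" if "u \<in> {0..1}" for u
    using x that by (auto simp: cadlag_C_def)
  have near: "bd S" if l: "l \<in> mspace (C0T T)" and S: "\<And>u. u \<in> S \<Longrightarrow> \<forall>t\<in>{0..T}. \<bar>x u t - l t\<bar> < 1" for l S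
  proof -
    obtain C where C: "\<And>t. t \<in> {0..T} \<Longrightarrow> \<bar>l t\<bar> \<le> C" using C0T_bounded[OF T l] by blast
    show ?thesis unfolding bd_def
    proof (intro exI[of _ "C + 1"] ballI)
      fix u t assume "u \<in> S \<inter> {0..1}" "t \<in> {0..T}"
      then have "\<bar>x u t - l t\<bar> < 1" "\<bar>l t\<bar> \<le> C" using S C by auto
      then show "\<bar>x u t\<bar> \<le> C + 1" by linarith
    qed
  qed
  have "bd {0..1}"
  proof (rule Bolzano[where a=0 and b=1 and P="\<lambda>a b. bd {a..b}"])
    fix a b c assume "bd {a..b}" "bd {b..c}" "a \<le> b" "b \<le> c"
    then show "bd {a..c}" using bd_Un[of "{a..b}" "{b..c}"] by (simp add: ivl_disj_un)
  next
    fix u :: real assume u: "0 \<le> u" "u \<le> 1"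
    have "\<exists>d>0. bd {u-d<..<u}"
    proof (cases "u = 0")
      case True
      then show ?thesis by (intro exI[of _ 1]) (auto simp: bd_def)
    next
      case False
      then have "0 < u" using u by simp
      then obtain l where l: "limitin (mtopology_of (C0T T)) x l (at_left u)"
        using x u unfolding cadlag_C_def by blast
      then have ls: "l \<in> mspace (C0T T)"
        using Metric_space.limitin_mspace[OF Metric_space_mspace_mdist] unfolding mtopology_of_def by metis
      obtain d where "d < u" "\<forall>v>d. v < u \<longrightarrow> (\<forall>t\<in>{0..T}. \<bar>x v t - l t\<bar> < 1)"
        using limitin_C0T_uniform[OF T l zero_less_one] unfolding eventually_at_left_field by blast
      then have "bd {u - (u - d)<..<u}" by (intro near[OF ls]) simp
      then show ?thesis using \<open>d < u\<close> by (intro exI[of _ "u - d"]) simp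
    qed
    then obtain d where d: "d > 0" "bd {u-d<..<u}" by blast
    have "\<exists>d>0. bd {u<..<u+d}"
    proof (cases "u = 1")
      case True
      then show ?thesis by (intro exI[of _ 1]) (auto simp: bd_def)
    next
      case False
      then have "\<forall>\<^sub>F v in at_right u. \<forall>t\<in>{0..T}. \<bar>x v t - x u t\<bar> < 1"
        using u by (intro cadlag_C_right[OF x T]) auto
      then obtain d where "d > u" "\<forall>v>u. v < d \<longrightarrow> (\<forall>t\<in>{0..T}. \<bar>x v t - x u t\<bar> < 1)"
        unfolding eventually_at_right_field by blast
      then have "bd {u<..<u + (d - u)}" using u by (intro near[OF space[of u]]) simp_all
      then show ?thesis using \<open>d > u\<close> by (intro exI[of _ "d - u"]) simp
    qed
    then obtain d' where d': "d' > 0" "bd {u<..<u+d'}" by blast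
    have "bd {u}" using u by (intro near[OF space[of u]]) auto
    then have *: "bd ({u-d<..<u} \<union> ({u} \<union> {u<..<u+d'}))" by (intro bd_Un d d')
    show "\<exists>d>0. \<forall>a b. a \<le> u \<and> u \<le> b \<and> b - a < d \<longrightarrow> bd {a..b}"
      using d(1) d'(1) by (intro exI[of _ "min d d'"]) (auto intro!: bd_mono[OF *])
  qed simp_all
  then obtain C where "\<forall>u\<in>{0..1}. \<forall>t\<in>{0..T}. \<bar>x u t\<bar> \<le> C" unfolding bd_def by auto
  then have "\<bar>x u t\<bar> \<le> C" if "u \<in> {0..1}" "t \<in> {0..T}" for u t using that by blast
  then show thesis by (rule that)
qed

section \<open>Joint measurability of random fields\<close>

text \<open>Approximate the first argument from the right and the second one from the left by points of
  a grid. Right continuity has to be uniform in \<open>s\<close> because both arguments move.\<close>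

lemma measurable_random_field:
  fixes y :: "real \<Rightarrow> real \<Rightarrow> 'w \<Rightarrow> real"
  assumes meas: "\<And>u s. u \<in> {0..1} \<Longrightarrow> s \<in> {0..t} \<Longrightarrow> y u s \<in> borel_measurable F"
    and right: "\<And>\<omega> u e. \<omega> \<in> space F \<Longrightarrow> 0 \<le> u \<Longrightarrow> u < 1 \<Longrightarrow> 0 < e \<Longrightarrow>
      \<forall>\<^sub>F v in at_right u. \<forall>s\<in>{0..t}. \<bar>y v s \<omega> - y u s \<omega>\<bar> < e"
    and cont: "\<And>\<omega> u. \<omega> \<in> space F \<Longrightarrow> u \<in> {0..1} \<Longrightarrow> continuous_on {0..t} (\<lambda>s. y u s \<omega>)"
    and p: "p \<in> borel_measurable N" "\<And>z. z \<in> space N \<Longrightarrow> p z \<in> {0..1}"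
    and q: "q \<in> borel_measurable N" "\<And>z. z \<in> space N \<Longrightarrow> q z \<in> {0..t}"
    and r: "r \<in> N \<rightarrow>\<^sub>M F"
  shows "(\<lambda>z. y (p z) (q z) (r z)) \<in> borel_measurable N"
proof (cases "space N = {}")
  case True
  then show ?thesis by (intro borel_measurableI) simp
next
  case False
  then have t: "0 \<le> t" using q(2) by fastforce
  \<comment> \<open>The grid point for \<open>p z\<close> lies strictly to its right unless \<open>p z = 1\<close>, where the cut-off at \<open>1\<close>
    makes it exact. The grid point for \<open>q z\<close> is at most \<open>q z\<close>, hence in \<open>[0,t]\<close>.\<close>
  define P where "P n k = max 0 (min 1 ((real_of_int k + 1) / Suc n))" for n k
  define Q where "Q n k = max 0 (min t (real_of_int k / Suc n))" for n k
  define P' where "P' n z = P n \<lfloor>Suc n * p z\<rfloor>" for n z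
  define Q' where "Q' n z = Q n \<lfloor>Suc n * q z\<rfloor>" for n z
  have fl: "real_of_int \<lfloor>Suc n * x\<rfloor> / Suc n \<le> x" "x < (real_of_int \<lfloor>Suc n * x\<rfloor> + 1) / Suc n"
    "x - 1 / Suc n < real_of_int \<lfloor>Suc n * x\<rfloor> / Suc n" for n :: nat and x :: real
  proof -
    have *: "real_of_int \<lfloor>Suc n * x\<rfloor> \<le> Suc n * x" "Suc n * x < real_of_int \<lfloor>Suc n * x\<rfloor> + 1"
      by linarith+
    have "real_of_int \<lfloor>Suc n * x\<rfloor> / Suc n \<le> (Suc n * x) / Suc n" "(Suc n * x) / Suc n < (real_of_int \<lfloor>Suc n * x\<rfloor> + 1) / Suc n"
      by (intro divide_right_mono divide_strict_right_mono *; simp)+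
    then show "real_of_int \<lfloor>Suc n * x\<rfloor> / Suc n \<le> x" "x < (real_of_int \<lfloor>Suc n * x\<rfloor> + 1) / Suc n"
      "x - 1 / Suc n < real_of_int \<lfloor>Suc n * x\<rfloor> / Suc n"
      by (simp_all add: add_divide_distrib del: of_nat_Suc)
  qed
  have approx: "(\<lambda>z. y (P' n z) (Q' n z) (r z)) \<in> borel_measurable N" for n
  proof -
    have "(\<lambda>z. (\<lambda>k z. y (P n (fst k)) (Q n (snd k)) (r z)) (\<lfloor>Suc n * p z\<rfloor>, \<lfloor>Suc n * q z\<rfloor>) z) \<in> borel_measurable N"
    proof (rule measurable_compose_countable[where f="\<lambda>k z. y (P n (fst k)) (Q n (snd k)) (r z)"])
      fix k :: "int \<times> int"
      show "(\<lambda>z. y (P n (fst k)) (Q n (snd k)) (r z)) \<in> borel_measurable N"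
        using t by (intro measurable_compose[OF r] meas) (auto simp: P_def Q_def)
    next
      note p(1)[measurable] q(1)[measurable]
      show "(\<lambda>z. (\<lfloor>Suc n * p z\<rfloor>, \<lfloor>Suc n * q z\<rfloor>)) \<in> N \<rightarrow>\<^sub>M count_space UNIV"
        by measurable
    qed
    then show ?thesis by (simp add: P'_def Q'_def)
  qed
  have inv: "(\<lambda>n. 1 / real (Suc n)) \<longlonglongrightarrow> 0"
    using LIMSEQ_inverse_real_of_nat by (simp add: inverse_eq_divide)
  show ?thesis
  proof (rule borel_measurable_LIMSEQ_real[OF _ approx])
    fix z assume z: "z \<in> space N"
    have pz: "p z \<in> {0..1}" and qz: "q z \<in> {0..t}" using p q z by auto
    have w: "r z \<in> space F" using r z by (auto dest: measurable_space)
    have Q't: "Q' n z \<in> {0..t}" for n using t by (auto simp: Q'_def Q_def)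
    have Q'b: "q z - 1 / real (Suc n) \<le> Q' n z \<and> Q' n z \<le> q z" for n
    proof -
      define w e where "w = real_of_int \<lfloor>Suc n * q z\<rfloor> / Suc n" and "e = 1 / real (Suc n)"
      have "w \<le> q z" "q z - e < w" "0 < e" using fl(1,3)[where x="q z" and n=n] by (auto simp: w_def e_def)
      then show ?thesis using qz unfolding Q'_def Q_def w_def[symmetric] e_def[symmetric] by auto
    qed
    have P'b: "p z \<le> P' n z \<and> P' n z \<le> p z + 1 / real (Suc n) \<and> (p z < 1 \<longrightarrow> p z < P' n z)" for n
    proof -
      define w e where "w = (real_of_int \<lfloor>Suc n * p z\<rfloor> + 1) / Suc n" and "e = 1 / real (Suc n)"
      have "p z < w" "w \<le> p z + e" "0 < e"
        using fl(1,2)[where x="p z" and n=n] by (auto simp: w_def e_def add_divide_distrib)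
      then show ?thesis using pz unfolding P'_def P_def w_def[symmetric] e_def[symmetric] by auto
    qed
    have Qlim: "(\<lambda>n. Q' n z) \<longlonglongrightarrow> q z"
    proof (rule tendsto_sandwich)
      show "(\<lambda>n. q z - 1 / real (Suc n)) \<longlonglongrightarrow> q z"
        using tendsto_diff[OF tendsto_const inv, of "q z"] by simp
      show "(\<lambda>n. q z) \<longlonglongrightarrow> q z" by simp
    qed (use Q'b in \<open>auto intro!: always_eventually\<close>)
    have Plim: "(\<lambda>n. P' n z) \<longlonglongrightarrow> p z"
    proof (rule tendsto_sandwich)
      show "(\<lambda>n. p z) \<longlonglongrightarrow> p z" by simp
      show "(\<lambda>n. p z + 1 / real (Suc n)) \<longlonglongrightarrow> p z"
        using tendsto_add[OF tendsto_const inv, of "p z"] by simp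
    qed (use P'b in \<open>auto intro!: always_eventually\<close>)
    have near: "\<forall>\<^sub>F n in sequentially. \<forall>s\<in>{0..t}. \<bar>y (P' n z) s (r z) - y (p z) s (r z)\<bar> < e" if "e > 0" for e
    proof (cases "p z = 1")
      case True
      have "P' n z \<le> 1" for n by (simp add: P'_def P_def)
      then have "P' n z = 1" for n using P'b[of n] True by (auto intro: antisym)
      then show ?thesis using True that by simp
    next
      case False
      with pz have lt: "0 \<le> p z" "p z < 1" by auto
      have "P' n z > p z" for n using P'b lt by blast
      then have "filterlim (\<lambda>n. P' n z) (at_right (p z)) sequentially"
        using Plim by (intro tendsto_imp_filterlim_at_right) (auto intro!: always_eventually)
      then show ?thesis
        using right[OF w lt that] unfolding filterlim_iff by blast
    qed
    have c: "(\<lambda>n. y (p z) (Q' n z) (r z)) \<longlonglongrightarrow> y (p z) (q z) (r z)"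
      by (rule continuous_on_tendsto_compose[OF cont[OF w pz] Qlim qz]) (use Q't in auto)
    have "(\<lambda>n. y (P' n z) (Q' n z) (r z) - y (p z) (Q' n z) (r z)) \<longlonglongrightarrow> 0"
    proof (rule tendstoI)
      fix e :: real assume "0 < e"
      from near[OF this] show "\<forall>\<^sub>F n in sequentially. dist (y (P' n z) (Q' n z) (r z) - y (p z) (Q' n z) (r z)) 0 < e"
        by eventually_elim (use Q't in \<open>auto simp: dist_real_def\<close>)
    qed
    from tendsto_add[OF this c] show "(\<lambda>n. y (P' n z) (Q' n z) (r z)) \<longlonglongrightarrow> y (p z) (q z) (r z)"
      by simp
  qed
qed

section \<open>Projection onto the functions of a step function\<close>

definition level_set :: "(real \<Rightarrow> real) \<Rightarrow> real \<Rightarrow> real set" where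
  "level_set b u = {v \<in> {0..1}. b v = b u}"

definition level_mass :: "(real \<Rightarrow> real) \<Rightarrow> real \<Rightarrow> real" where
  "level_mass b u = measure unit_lebesgue (level_set b u)"

definition level_kernel :: "(real \<Rightarrow> real) \<Rightarrow> real \<Rightarrow> real \<Rightarrow> real" where
  "level_kernel b u v = (if b u = b v then 1 / level_mass b u else 0)"

text \<open>The conditional expectation of \<open>a\<close> given \<open>\<sigma>(b)\<close> on \<open>[0,1]\<close>, for a step function \<open>b\<close>.\<close>

definition level_average :: "(real \<Rightarrow> real) \<Rightarrow> (real \<Rightarrow> real) \<Rightarrow> real \<Rightarrow> real" where
  "level_average b a u = (LINT v|unit_lebesgue. a v * level_kernel b u v)"

lemma level_set_sets:
  assumes "b \<in> borel_measurable unit_lebesgue"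
  shows "level_set b u \<in> sets unit_lebesgue"
proof -
  have "level_set b u = b -` {b u} \<inter> space unit_lebesgue" by (auto simp: level_set_def)
  then show ?thesis using measurable_sets[OF assms, of "{b u}"] by simp
qed

text \<open>In this form the mass depends measurably on parameters of \<open>b\<close>, by the measurability part of
  Fubini's theorem.\<close>

lemma level_mass_eq_integral:
  "level_mass b u = (LINT v|unit_lebesgue. (if b v = b u then 1 else 0))"
proof -
  have "(LINT v|unit_lebesgue. (if b v = b u then 1 else 0)) = (LINT v|unit_lebesgue. indicator (level_set b u) v :: real)"
    by (rule Bochner_Integration.integral_cong) (auto simp: level_set_def)
  also have "\<dots> = level_mass b u"
    unfolding level_mass_def Bochner_Integration.integral_indicator
    by (rule arg_cong[where f="measure unit_lebesgue"]) (auto simp: level_set_def)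
  finally show ?thesis by simp
qed

lemma step_function_finite_range:
  assumes "step_function b"
  shows "finite (b ` {0..1})"
proof -
  obtain P where P: "finite P"
    "\<And>u v. u \<in> {0..1} \<Longrightarrow> v \<in> {0..1} \<Longrightarrow> u \<le> v \<Longrightarrow> {u..v} \<inter> P = {} \<Longrightarrow> b u = b v"
    using assms unfolding step_function_def by blast
  \<comment> \<open>The second component separates a jump position from the open interval to its right.\<close>
  define c where "c u = (P \<inter> {..u}, P \<inter> {..<u})" for u
  have le: "b u = b v" if "u \<in> {0..1}" "v \<in> {0..1}" "c u = c v" "u \<le> v" for u v
  proof (cases "u = v")
    case False
    have "x \<notin> P" if "x \<in> {u..v}" for x
    proof
      assume "x \<in> P"
      then have "x \<in> P \<inter> {..u}" using that \<open>c u = c v\<close> by (auto simp: c_def)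
      then have "x = u" using that by auto
      then have "u \<in> P \<inter> {..<u}" using \<open>x \<in> P\<close> False \<open>u \<le> v\<close> \<open>c u = c v\<close> by (auto simp: c_def)
      then show False by simp
    qed
    then show ?thesis using P(2) that by blast
  qed simp
  have eq: "b u = b v" if "u \<in> {0..1}" "v \<in> {0..1}" "c u = c v" for u v
    using le[of u v] le[of v u] that by fastforce
  have "finite (c ` {0..1})"
    by (rule finite_subset[of _ "Pow P \<times> Pow P"]) (use P(1) in \<open>auto simp: c_def\<close>)
  moreover have "b ` {0..1} \<subseteq> (\<lambda>k. b (SOME u. u \<in> {0..1} \<and> c u = k)) ` c ` {0..1}"
  proof
    fix x assume "x \<in> b ` {0..1}"
    then obtain u where u: "u \<in> {0..1}" "x = b u" by auto
    have "(SOME v. v \<in> {0..1} \<and> c v = c u) \<in> {0..1} \<and> c (SOME v. v \<in> {0..1} \<and> c v = c u) = c u"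
      using u by (intro someI[of "\<lambda>v. v \<in> {0..1} \<and> c v = c u" u]) simp
    then have "b (SOME v. v \<in> {0..1} \<and> c v = c u) = b u"
      using eq u by blast
    then show "x \<in> (\<lambda>k. b (SOME u. u \<in> {0..1} \<and> c u = k)) ` c ` {0..1}"
      using u by (intro image_eqI[of _ _ "c u"]) auto
  qed
  ultimately show ?thesis by (auto intro: finite_surj)
qed

text \<open>A step function is constant just to the right of \<open>u\<close>, and right continuity extends the constant
  value to \<open>u\<close> itself. At \<open>u = 1\<close> a level may be a single point.\<close>

lemma level_mass_pos:
  assumes b: "step_function b" "b \<in> borel_measurable unit_lebesgue"
    and u: "0 \<le> u" "u < 1" and right: "(b \<longlongrightarrow> b u) (at_right u)"
  shows "0 < level_mass b u"
proof -
  obtain P where P: "finite P"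
    "\<And>u v. u \<in> {0..1} \<Longrightarrow> v \<in> {0..1} \<Longrightarrow> u \<le> v \<Longrightarrow> {u..v} \<inter> P = {} \<Longrightarrow> b u = b v"
    using b(1) unfolding step_function_def by blast
  define w where "w = Min (insert 1 {x \<in> P. u < x})"
  have w: "u < w" "w \<le> 1" "\<And>x. x \<in> P \<Longrightarrow> u < x \<Longrightarrow> w \<le> x"
    using P(1) u by (auto simp: w_def)
  have const: "b v = b v'" if "u < v" "v \<le> v'" "v' < w" for v v'
    using w u that by (intro P(2)) force+
  define m where "m = (u + w) / 2"
  have m: "u < m" "m < w" using w by (auto simp: m_def)
  have "\<forall>\<^sub>F v in at_right u. b v = b m"
    unfolding eventually_at_right_field
    by (rule exI[of _ m]) (use m const in auto)
  then have "(b \<longlongrightarrow> b m) (at_right u)" by (rule tendsto_eventually)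
  then have bm: "b m = b u" using right by (intro tendsto_unique[of "at_right u"]) auto
  have "b v = b u" if "v \<in> {u<..<w}" for v
    using const[of v m] const[of m v] that m bm by (cases "v \<le> m") auto
  then have "{u<..<w} \<subseteq> level_set b u" using w u by (auto simp: level_set_def)
  moreover have "level_set b u \<in> sets unit_lebesgue" using b(2) by (rule level_set_sets)
  ultimately have "measure unit_lebesgue {u<..<w} \<le> level_mass b u"
    unfolding level_mass_def
    by (intro finite_measure.finite_measure_mono[OF finite_measure_unit])
  moreover have "measure unit_lebesgue {u<..<w} = w - u"
    using w u by (subst measure_restrict_space) auto
  ultimately show ?thesis using w by simp
qed

lemma L2_integrable:
  assumes "a \<in> L2_01" shows "integrable unit_lebesgue a"
proof -
  interpret finite_measure unit_lebesgue by (rule finite_measure_unit)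
  show ?thesis
  proof (rule Bochner_Integration.integrable_bound[of _ "\<lambda>u. 1 + (a u)\<^sup>2"])
    show "integrable unit_lebesgue (\<lambda>u. 1 + (a u)\<^sup>2)" using assms by (auto simp: L2_01_def)
    show "a \<in> borel_measurable unit_lebesgue" using assms by (auto simp: L2_01_def)
    have "\<bar>x\<bar> \<le> 1 + x\<^sup>2" for x :: real
      using zero_le_power2[of "\<bar>x\<bar> - 1"] unfolding power2_diff by auto
    then show "AE x in unit_lebesgue. norm (a x) \<le> norm (1 + (a x)\<^sup>2)"
      by (intro AE_I2) (auto simp: abs_of_nonneg)
  qed
qed

lemma L2_mult_integrable:
  assumes "f \<in> L2_01" "g \<in> L2_01" shows "integrable unit_lebesgue (\<lambda>u. f u * g u)"
proof (rule Bochner_Integration.integrable_bound[of _ "\<lambda>u. (f u)\<^sup>2 + (g u)\<^sup>2"])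
  show "integrable unit_lebesgue (\<lambda>u. (f u)\<^sup>2 + (g u)\<^sup>2)" using assms by (auto simp: L2_01_def)
  show "(\<lambda>u. f u * g u) \<in> borel_measurable unit_lebesgue" using assms by (auto simp: L2_01_def)
  have "\<bar>x * z\<bar> \<le> x\<^sup>2 + z\<^sup>2" for x z :: real
    using zero_le_power2[of "\<bar>x\<bar> - \<bar>z\<bar>"] zero_le_power2[of x] zero_le_power2[of z]
    unfolding power2_diff abs_mult by (simp add: abs_mult; linarith)
  then show "AE x in unit_lebesgue. norm (f x * g x) \<le> norm ((f x)\<^sup>2 + (g x)\<^sup>2)"
    by (intro AE_I2) (auto simp: abs_of_nonneg)
qed

lemma L2_abs: "a \<in> L2_01 \<Longrightarrow> (\<lambda>u. \<bar>a u\<bar>) \<in> L2_01"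
  by (auto simp: L2_01_def)

lemma inner_L2_diff_left:
  "f \<in> L2_01 \<Longrightarrow> g \<in> L2_01 \<Longrightarrow> h \<in> L2_01 \<Longrightarrow> inner_L2 (\<lambda>u. f u - g u) h = inner_L2 f h - inner_L2 g h"
  unfolding inner_L2_def by (simp add: left_diff_distrib L2_mult_integrable)

lemma inner_L2_commute: "inner_L2 f g = inner_L2 g f"
  by (simp add: inner_L2_def mult.commute)

lemma inner_L2_self_nonneg: "0 \<le> inner_L2 f f"
  by (simp add: inner_L2_def)

text \<open>Any two solutions of the projection problem have the same norm, so the choice made by
  \<^const>\<open>pr_L2\<close> is irrelevant once one solution is known.\<close>

lemma norm_pr_L2_eq:
  assumes a: "a \<in> L2_01" and g: "g \<in> sigma_meas_L2 b"
    and orth: "\<And>h. h \<in> sigma_meas_L2 b \<Longrightarrow> inner_L2 (\<lambda>u. a u - g u) h = 0"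
  shows "(norm_L2 (pr_L2 b a))\<^sup>2 = inner_L2 a g" "inner_L2 a g \<le> inner_L2 a a" "0 \<le> inner_L2 a g"
proof -
  define g' where "g' = pr_L2 b a"
  have "g' \<in> sigma_meas_L2 b \<and> (\<forall>h\<in>sigma_meas_L2 b. inner_L2 (\<lambda>u. a u - g' u) h = 0)"
    unfolding g'_def pr_L2_def
    by (rule someI[of "\<lambda>g. g \<in> sigma_meas_L2 b \<and> (\<forall>h\<in>sigma_meas_L2 b. inner_L2 (\<lambda>u. a u - g u) h = 0)"])
       (use g orth in auto)
  then have g': "g' \<in> sigma_meas_L2 b"
    and orth': "\<And>h. h \<in> sigma_meas_L2 b \<Longrightarrow> inner_L2 (\<lambda>u. a u - g' u) h = 0" by auto
  have L2: "g \<in> L2_01" "g' \<in> L2_01" using g g' by (auto simp: sigma_meas_L2_def)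
  have 1: "inner_L2 a g' = inner_L2 g g'" using orth[OF g'] inner_L2_diff_left[OF a L2(1) L2(2)] by simp
  have 2: "inner_L2 a g' = inner_L2 g' g'" using orth'[OF g'] inner_L2_diff_left[OF a L2(2) L2(2)] by simp
  have 3: "inner_L2 a g = inner_L2 g' g" using orth'[OF g] inner_L2_diff_left[OF a L2(2) L2(1)] by simp
  have 4: "inner_L2 a g = inner_L2 g g" using orth[OF g] inner_L2_diff_left[OF a L2(1) L2(1)] by simp
  show "(norm_L2 (pr_L2 b a))\<^sup>2 = inner_L2 a g"
    using 1 2 3 inner_L2_self_nonneg[of g'] inner_L2_commute[of g g']
    by (simp add: norm_L2_def g'_def[symmetric])
  show "0 \<le> inner_L2 a g" unfolding 4 by (rule inner_L2_self_nonneg)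
  have d: "(\<lambda>u. a u - g u) \<in> L2_01"
  proof -
    have "integrable unit_lebesgue (\<lambda>u. (a u)\<^sup>2 + (g u)\<^sup>2 - 2 * (a u * g u))"
      using a L2(1) L2_mult_integrable[OF a L2(1)] by (auto simp: L2_01_def)
    then show ?thesis using a L2(1) by (auto simp: L2_01_def power2_diff mult.assoc)
  qed
  have "0 \<le> inner_L2 (\<lambda>u. a u - g u) (\<lambda>u. a u - g u)" by (rule inner_L2_self_nonneg)
  also have "\<dots> = inner_L2 (\<lambda>u. a u - g u) a - inner_L2 (\<lambda>u. a u - g u) g"
    using inner_L2_diff_left[OF a L2(1) d] by (simp only: inner_L2_commute[of a] inner_L2_commute[of g])
  also have "\<dots> = inner_L2 a a - inner_L2 a g"
    using orth[OF g] inner_L2_diff_left[OF a L2(1) a] inner_L2_commute[of a g] by simp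
  finally show "inner_L2 a g \<le> inner_L2 a a" by simp
qed

text \<open>Preimages under a \<open>\<sigma>(b)\<close>-measurable function are preimages under \<open>b\<close>, so they cannot
  separate points of one level.\<close>

lemma sigma_meas_const_on_level:
  assumes "h \<in> sigma_meas_L2 b" "u \<in> {0..1}" "v \<in> {0..1}" "b u = b v"
  shows "h u = h v"
proof -
  have "h \<in> borel_measurable (vimage_algebra {0..1} b borel)"
    using assms by (simp add: sigma_meas_L2_def)
  then have "h -` {h u} \<inter> {0..1} \<in> sets (vimage_algebra {0..1} b borel)"
    using measurable_sets[of h "vimage_algebra {0..1} b borel" borel "{h u}"] by (simp del: atLeastAtMost_iff)
  then obtain A where "h -` {h u} \<inter> {0..1} = b -` A \<inter> {0..1}"
    by (auto simp: sets_vimage_algebra2)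
  then have "u \<in> h -` {h u} \<inter> {0..1} \<longleftrightarrow> u \<in> b -` A \<inter> {0..1}"
    "v \<in> h -` {h u} \<inter> {0..1} \<longleftrightarrow> v \<in> b -` A \<inter> {0..1}" by simp_all
  then show ?thesis using assms(2-4) by simp
qed

text \<open>With finitely many levels everything reduces to finite sums over representatives of
  the levels. A level of mass zero carries no part of \<open>a\<close>, which is why the value 1/0 = 0 used
  there is harmless.\<close>

lemma level_average_projection:
  assumes fin: "finite (b ` {0..1})" and b: "b \<in> borel_measurable unit_lebesgue" and a: "a \<in> L2_01"
  shows "level_average b a \<in> sigma_meas_L2 b"
    and "h \<in> sigma_meas_L2 b \<Longrightarrow> inner_L2 (\<lambda>u. a u - level_average b a u) h = 0"
    and "integrable unit_lebesgue (\<lambda>v. a v * level_kernel b u v)"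
proof -
  interpret finite_measure unit_lebesgue by (rule finite_measure_unit)
  define rep where "rep c = (SOME u. u \<in> {0..1} \<and> b u = c)" for c
  define J where "J = b ` {0..1}"
  have rep: "rep c \<in> {0..1}" "b (rep c) = c" if "c \<in> J" for c
  proof -
    have "\<exists>u. u \<in> {0..1} \<and> b u = c" using that unfolding J_def by blast
    from someI_ex[OF this] show "rep c \<in> {0..1}" "b (rep c) = c" unfolding rep_def by blast+
  qed
  define g where "g = level_average b a"
  have sets: "level_set b u \<in> sets unit_lebesgue" for u using b by (rule level_set_sets)
  have J: "finite J" using fin by (simp add: J_def)
  \<comment> \<open>A function that is constant on levels is a finite combination of indicators of levels.\<close>
  have dec: "f u = (\<Sum>c\<in>J. f (rep c) * indicator (level_set b (rep c)) u)"
    if f: "\<And>u v. u \<in> {0..1} \<Longrightarrow> v \<in> {0..1} \<Longrightarrow> b u = b v \<Longrightarrow> f u = f v" and u: "u \<in> {0..1}"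
    for f :: "real \<Rightarrow> real" and u
  proof -
    have bu: "b u \<in> J" using u by (simp add: J_def)
    have "(\<Sum>c\<in>J. f (rep c) * indicator (level_set b (rep c)) u) = (\<Sum>c\<in>J. if c = b u then f u else 0)"
    proof (rule sum.cong[OF refl])
      fix c assume c: "c \<in> J"
      show "f (rep c) * indicator (level_set b (rep c)) u = (if c = b u then f u else 0)"
        using rep[OF c] u f[of "rep c" u] by (auto simp: level_set_def)
    qed
    also have "\<dots> = f u" using J bu by simp
    finally show ?thesis by simp
  qed
  have kern: "level_kernel b u v = indicator (level_set b u) v / level_mass b u" if "v \<in> {0..1}" for u v
    using that by (auto simp: level_kernel_def level_set_def)
  have aI: "integrable unit_lebesgue (\<lambda>v. a v * indicator (level_set b u) v)" for u
    using L2_integrable[OF a] sets by (rule integrable_real_mult_indicator[rotated])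
  show int: "integrable unit_lebesgue (\<lambda>v. a v * level_kernel b u v)" for u
  proof -
    have "integrable unit_lebesgue (\<lambda>v. a v * indicator (level_set b u) v / level_mass b u)"
      using aI by simp
    then show ?thesis
      by (rule Bochner_Integration.integrable_cong[THEN iffD1, rotated -1]) (auto simp: kern)
  qed
  define \<alpha> where "\<alpha> u = (LINT v|unit_lebesgue. a v * indicator (level_set b u) v)" for u
  have g_eq: "g u = \<alpha> u / level_mass b u" for u
  proof -
    have "g u = (LINT v|unit_lebesgue. a v * indicator (level_set b u) v / level_mass b u)"
      unfolding g_def level_average_def by (rule Bochner_Integration.integral_cong) (auto simp: kern)
    then show ?thesis by (simp add: \<alpha>_def)
  qed
  have cap: "level_set b u \<inter> {0..1} = level_set b u" for u by (auto simp: level_set_def)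
  \<comment> \<open>If the mass vanishes then so does the integral over the level.\<close>
  have g_mass: "g u * level_mass b u = \<alpha> u" for u
  proof (cases "level_mass b u = 0")
    case True
    then have "emeasure unit_lebesgue (level_set b u) = 0"
      by (simp add: level_mass_def emeasure_eq_measure)
    then have "level_set b u \<in> null_sets unit_lebesgue" using sets by auto
    then have "AE v in unit_lebesgue. a v * indicator (level_set b u) v = 0"
      by (rule AE_not_in[THEN AE_mp]) auto
    then have "\<alpha> u = 0" unfolding \<alpha>_def by (rule integral_eq_zero_AE)
    then show ?thesis using True by simp
  qed (simp add: g_eq)
  have g_const: "g u = g v" if "b u = b v" for u v
  proof -
    have "level_mass b u = level_mass b v" using that by (simp add: level_mass_def level_set_def)
    then have "level_kernel b u = level_kernel b v" using that by (intro ext) (simp add: level_kernel_def)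
    then show ?thesis by (simp add: g_def level_average_def)
  qed
  have g_sum: "g u = (\<Sum>c\<in>J. g (rep c) * indicator (level_set b (rep c)) u)" if "u \<in> {0..1}" for u
    by (rule dec[where f=g, OF _ that], rule g_const)
  have inner_a: "inner_L2 a f = (\<Sum>c\<in>J. f (rep c) * \<alpha> (rep c))"
    if f: "\<And>u v. u \<in> {0..1} \<Longrightarrow> v \<in> {0..1} \<Longrightarrow> b u = b v \<Longrightarrow> f u = f v" for f
  proof -
    have "inner_L2 a f = (LINT u|unit_lebesgue. (\<Sum>c\<in>J. f (rep c) * (a u * indicator (level_set b (rep c)) u)))"
      unfolding inner_L2_def
    proof (rule Bochner_Integration.integral_cong[OF refl])
      fix u assume "u \<in> space unit_lebesgue"
      then have "u \<in> {0..1}" by simp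
      with f have "f u = (\<Sum>c\<in>J. f (rep c) * indicator (level_set b (rep c)) u)"
        by (rule dec)
      then show "a u * f u = (\<Sum>c\<in>J. f (rep c) * (a u * indicator (level_set b (rep c)) u))"
        by (simp add: sum_distrib_left mult_ac)
    qed
    also have "\<dots> = (\<Sum>c\<in>J. f (rep c) * \<alpha> (rep c))"
      using aI by (subst Bochner_Integration.integral_sum) (auto simp: \<alpha>_def)
    finally show ?thesis .
  qed
  have inner_g: "inner_L2 g f = (\<Sum>c\<in>J. f (rep c) * \<alpha> (rep c))"
    if f: "\<And>u v. u \<in> {0..1} \<Longrightarrow> v \<in> {0..1} \<Longrightarrow> b u = b v \<Longrightarrow> f u = f v" for f
  proof -
    have "inner_L2 g f = (LINT u|unit_lebesgue. (\<Sum>c\<in>J. g (rep c) * f (rep c) * indicator (level_set b (rep c)) u))"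
      unfolding inner_L2_def
    proof (rule Bochner_Integration.integral_cong[OF refl])
      fix u assume "u \<in> space unit_lebesgue"
      then have u: "u \<in> {0..1}" by simp
      show "g u * f u = (\<Sum>c\<in>J. g (rep c) * f (rep c) * indicator (level_set b (rep c)) u)"
      proof (rule dec[where f="\<lambda>u. g u * f u", OF _ u])
        fix v w assume *: "v \<in> {0..1}" "w \<in> {0..1}" "b v = b w"
        show "g v * f v = g w * f w" using f[OF *] g_const[OF *(3)] by simp
      qed
    qed
    also have "\<dots> = (\<Sum>c\<in>J. g (rep c) * f (rep c) * level_mass b (rep c))"
      using sets by (subst Bochner_Integration.integral_sum)
        (auto intro!: integrable_real_indicator sum.cong simp: emeasure_eq_measure level_mass_def cap)
    also have "\<dots> = (\<Sum>c\<in>J. f (rep c) * \<alpha> (rep c))"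
      by (simp add: g_mass[symmetric] mult_ac)
    finally show ?thesis .
  qed
  have g_meas: "g \<in> borel_measurable unit_lebesgue"
    using sets by (subst measurable_cong[OF g_sum]) auto
  have "g \<in> L2_01"
  proof -
    define C where "C = (\<Sum>c\<in>J. \<bar>g (rep c)\<bar>)"
    have bound: "\<bar>g u\<bar> \<le> C" if "u \<in> {0..1}" for u
    proof -
      have "\<bar>g u\<bar> \<le> (\<Sum>c\<in>J. \<bar>g (rep c) * indicator (level_set b (rep c)) u\<bar>)"
        unfolding g_sum[OF that] by (rule sum_abs)
      also have "\<dots> \<le> C" unfolding C_def
        by (rule sum_mono) (auto simp: indicator_def)
      finally show ?thesis .
    qed
    have "integrable unit_lebesgue (\<lambda>u. (g u)\<^sup>2)"
    proof (rule integrable_const_bound[of _ "C\<^sup>2"])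
      show "AE x in unit_lebesgue. norm ((g x)\<^sup>2) \<le> C\<^sup>2"
        using power_mono[OF bound abs_ge_zero, of _ 2] by (intro AE_I2) simp
    qed (use g_meas in simp)
    then show ?thesis using g_meas by (simp add: L2_01_def)
  qed
  moreover have "g \<in> borel_measurable (vimage_algebra {0..1} b borel)"
  proof -
    have bm: "b \<in> borel_measurable (vimage_algebra {0..1} b borel)"
      by (rule measurable_vimage_algebra1) simp
    have "(\<lambda>u. \<Sum>c\<in>J. g (rep c) * indicator {c} (b u)) \<in> borel_measurable (vimage_algebra {0..1} b borel)"
      using bm by measurable
    moreover have "g u = (\<Sum>c\<in>J. g (rep c) * indicator {c} (b u))" if "u \<in> {0..1}" for u
      unfolding g_sum[OF that] using rep that by (intro sum.cong) (auto simp: level_set_def indicator_def)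
    ultimately show ?thesis by (subst measurable_cong) auto
  qed
  ultimately show g: "level_average b a \<in> sigma_meas_L2 b"
    by (simp add: g_def sigma_meas_L2_def)
  show "inner_L2 (\<lambda>u. a u - level_average b a u) h = 0" if "h \<in> sigma_meas_L2 b"
  proof -
    have "\<And>u v. u \<in> {0..1} \<Longrightarrow> v \<in> {0..1} \<Longrightarrow> b u = b v \<Longrightarrow> h u = h v"
      using sigma_meas_const_on_level[OF that] by blast
    then have "inner_L2 a h = inner_L2 g h" using inner_a[of h] inner_g[of h] by metis
    then show ?thesis
      using inner_L2_diff_left[OF a, of g h] g that by (simp add: sigma_meas_L2_def g_def)
  qed
qed

lemma inner_level_average:
  "inner_L2 a (level_average b a) = (LINT u|unit_lebesgue. LINT v|unit_lebesgue. a u * a v * level_kernel b u v)"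
  unfolding inner_L2_def level_average_def by (simp add: mult.assoc)

lemma level_kernel_nonneg: "0 \<le> level_kernel b u v"
  by (simp add: level_kernel_def level_mass_def)

text \<open>The left-hand side equals \<open>(\<bar>a\<bar>, pr \<bar>a\<bar>)\<close>, which a projection keeps below \<open>\<parallel>a\<parallel>\<^sup>2\<close>. The bound
  does not depend on the masses of the levels, although the kernel does.\<close>

lemma nn_integral_level_kernel_le:
  assumes fin: "finite (b ` {0..1})" and b: "b \<in> borel_measurable unit_lebesgue" and a: "a \<in> L2_01"
  shows "(\<integral>\<^sup>+u. \<integral>\<^sup>+v. ennreal (\<bar>a u * a v\<bar> * level_kernel b u v) \<partial>unit_lebesgue \<partial>unit_lebesgue)
    \<le> ennreal (inner_L2 a a)"
proof -
  let ?a = "\<lambda>u. \<bar>a u\<bar>"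
  note proj = level_average_projection[OF fin b L2_abs[OF a]]
  have avg: "level_average b ?a \<in> L2_01" using proj(1) by (simp add: sigma_meas_L2_def)
  have avg_nonneg: "0 \<le> level_average b ?a u" for u
    unfolding level_average_def by (intro integral_nonneg_AE AE_I2) (simp add: level_kernel_nonneg)
  have "(\<integral>\<^sup>+u. \<integral>\<^sup>+v. ennreal (\<bar>a u * a v\<bar> * level_kernel b u v) \<partial>unit_lebesgue \<partial>unit_lebesgue)
    = (\<integral>\<^sup>+u. ennreal (?a u * level_average b ?a u) \<partial>unit_lebesgue)"
  proof (rule nn_integral_cong)
    fix u
    have "(\<integral>\<^sup>+v. ennreal (\<bar>a u * a v\<bar> * level_kernel b u v) \<partial>unit_lebesgue)
      = (\<integral>\<^sup>+v. ennreal (?a u * (?a v * level_kernel b u v)) \<partial>unit_lebesgue)"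
      by (simp add: abs_mult mult.assoc)
    also have "\<dots> = ennreal (LINT v|unit_lebesgue. ?a u * (?a v * level_kernel b u v))"
      using proj(3) by (intro nn_integral_eq_integral) (auto simp: level_kernel_nonneg)
    finally show "(\<integral>\<^sup>+v. ennreal (\<bar>a u * a v\<bar> * level_kernel b u v) \<partial>unit_lebesgue)
      = ennreal (?a u * level_average b ?a u)"
      by (simp add: level_average_def)
  qed
  also have "\<dots> = ennreal (inner_L2 ?a (level_average b ?a))"
    unfolding inner_L2_def using L2_mult_integrable[OF L2_abs[OF a] avg] avg_nonneg
    by (intro nn_integral_eq_integral) auto
  also have "\<dots> \<le> ennreal (inner_L2 ?a ?a)"
    by (intro ennreal_leI norm_pr_L2_eq(2)[OF L2_abs[OF a] proj(1)] proj(2))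
  also have "inner_L2 ?a ?a = inner_L2 a a"
    by (simp add: inner_L2_def)
  finally show ?thesis .
qed

section \<open>Mixtures of martingales\<close>

text \<open>In terms of integrals over events, the martingale property is preserved by Fubini's theorem and
  by modifications on null sets.\<close>

lemma martingale_on_iff_set_integral:
  assumes "prob_space M"
  shows "martingale_on M F T X \<longleftrightarrow>
     (\<forall>t\<in>{0..T}. subalgebra M (F t) \<and> X t \<in> borel_measurable (F t) \<and> integrable M (X t)) \<and>
     (\<forall>s\<in>{0..T}. \<forall>t\<in>{s..T}. \<forall>B\<in>sets (F s). (LINT \<omega>:B|M. X t \<omega>) = (LINT \<omega>:B|M. X s \<omega>))"
    (is "_ \<longleftrightarrow> ?R \<and> ?S")
proof -
  interpret prob_space M by fact
  have "(AE \<omega> in M. real_cond_exp M (F s) (X t) \<omega> = X s \<omega>) \<longleftrightarrow>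
      (\<forall>B\<in>sets (F s). (LINT \<omega>:B|M. X t \<omega>) = (LINT \<omega>:B|M. X s \<omega>))" (is "?P \<longleftrightarrow> ?Q")
    if R: ?R and s: "s \<in> {0..T}" and t: "t \<in> {s..T}" for s t
  proof -
    have t': "t \<in> {0..T}" using s t by auto
    have sub: "subalgebra M (F s)" using R s by auto
    have Xs: "X s \<in> borel_measurable (F s)" "integrable M (X s)" using R s by auto
    have Xt: "integrable M (X t)" using R t' by auto
    interpret finite_measure_subalgebra M "F s" by standard (rule sub)
    show ?thesis
    proof
      assume P: ?P
      show ?Q
      proof
        fix B assume B: "B \<in> sets (F s)"
        have BM: "B \<in> sets M" using B sub by (auto simp: subalgebra_def)
        have "(LINT \<omega>:B|M. X t \<omega>) = (LINT \<omega>:B|M. real_cond_exp M (F s) (X t) \<omega>)"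
          by (rule real_cond_exp_intA[OF Xt B])
        also have "\<dots> = (LINT \<omega>:B|M. X s \<omega>)"
          unfolding set_lebesgue_integral_def
        proof (rule integral_cong_AE)
          show "AE x in M. indicator B x *\<^sub>R real_cond_exp M (F s) (X t) x = indicator B x *\<^sub>R X s x"
            using P by eventually_elim simp
        qed (use BM Xs in auto)
        finally show "(LINT \<omega>:B|M. X t \<omega>) = (LINT \<omega>:B|M. X s \<omega>)" .
      qed
    next
      assume ?Q
      then show ?P using Xs Xt by (intro real_cond_exp_charact) auto
    qed
  qed
  then show ?thesis unfolding martingale_on_def by (intro conj_cong refl ball_cong) auto
qed

text \<open>Fubini exchanges the integral over a past event with the mixture. Only the integrals of the components over past events have to be constant in time, and only for
  almost every component. So a component may be a modification of a martingale whose null sets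
  depend on \<open>v\<close>.\<close>

lemma martingale_on_mixture:
  fixes Z :: "'v \<Rightarrow> real \<Rightarrow> 'w \<Rightarrow> real"
  assumes M: "prob_space M" and V: "sigma_finite_measure V"
    and sub: "\<And>t. t \<in> {0..T} \<Longrightarrow> subalgebra M (F t)"
    and adapted: "\<And>t. t \<in> {0..T} \<Longrightarrow> (\<lambda>(v, \<omega>). Z v t \<omega>) \<in> borel_measurable (V \<Otimes>\<^sub>M F t)"
    and int: "\<And>t. t \<in> {0..T} \<Longrightarrow> integrable (V \<Otimes>\<^sub>M M) (\<lambda>(v, \<omega>). Z v t \<omega>)"
    and mart: "\<And>s t B. s \<in> {0..T} \<Longrightarrow> t \<in> {s..T} \<Longrightarrow> B \<in> sets (F s) \<Longrightarrow>
      AE v in V. (LINT \<omega>:B|M. Z v t \<omega>) = (LINT \<omega>:B|M. Z v s \<omega>)"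
    and X: "\<And>t \<omega>. t \<in> {0..T} \<Longrightarrow> \<omega> \<in> space M \<Longrightarrow> X t \<omega> = (LINT v|V. Z v t \<omega>)"
  shows "martingale_on M F T X"
  unfolding martingale_on_iff_set_integral[OF M]
proof (intro conjI ballI sub)
  interpret prob_space M by fact
  interpret V: sigma_finite_measure V by fact
  interpret VM: pair_sigma_finite V M ..
  interpret MV: pair_sigma_finite M V ..
  have swap: "integrable (M \<Otimes>\<^sub>M V) (\<lambda>(\<omega>, v). Z v t \<omega>)" if "t \<in> {0..T}" for t
    using VM.integrable_product_swap[OF int[OF that]] by simp
  have meas_X: "X t \<in> borel_measurable (F t)" if t: "t \<in> {0..T}" for t
  proof -
    have "(\<lambda>(\<omega>, v). Z v t \<omega>) \<in> borel_measurable (F t \<Otimes>\<^sub>M V)"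
      using measurable_pair_swap[OF adapted[OF t]] by (simp add: case_prod_unfold)
    then have "(\<lambda>\<omega>. LINT v|V. Z v t \<omega>) \<in> borel_measurable (F t)"
      by (rule V.borel_measurable_lebesgue_integral)
    then show ?thesis
      using X[OF t] sub[OF t] by (subst measurable_cong) (auto simp: subalgebra_def)
  qed
  fix t assume t: "t \<in> {0..T}"
  show "X t \<in> borel_measurable (F t)" by (rule meas_X[OF t])
  have "integrable M (\<lambda>\<omega>. LINT v|V. Z v t \<omega>)"
    using MV.integrable_fst'[OF swap[OF t]] by simp
  then show "integrable M (X t)"
    using X[OF t] by (subst Bochner_Integration.integrable_cong[OF refl]) auto
next
  interpret prob_space M by fact
  interpret V: sigma_finite_measure V by fact
  interpret VM: pair_sigma_finite V M ..
  interpret MV: pair_sigma_finite M V ..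
  have swap: "(LINT \<omega>:B|M. X t \<omega>) = (LINT v|V. (LINT \<omega>:B|M. Z v t \<omega>))"
    if t: "t \<in> {0..T}" and B: "B \<in> sets M" for t B
  proof -
    have "integrable (V \<Otimes>\<^sub>M M) (\<lambda>z. indicator (space V \<times> B) z *\<^sub>R (case z of (v, \<omega>) \<Rightarrow> Z v t \<omega>))"
      using B by (intro integrable_mult_indicator int[OF t]) auto
    then have i: "integrable (V \<Otimes>\<^sub>M M) (\<lambda>(v, \<omega>). indicator B \<omega> *\<^sub>R Z v t \<omega>)"
      by (rule Bochner_Integration.integrable_cong[THEN iffD1, rotated -1])
        (auto simp: space_pair_measure indicator_def)
    have "(LINT \<omega>:B|M. X t \<omega>) = (LINT \<omega>|M. LINT v|V. indicator B \<omega> *\<^sub>R Z v t \<omega>)"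
      unfolding set_lebesgue_integral_def using X[OF t]
      by (intro Bochner_Integration.integral_cong refl) simp
    also have "\<dots> = (LINT v|V. LINT \<omega>|M. indicator B \<omega> *\<^sub>R Z v t \<omega>)"
      by (rule VM.Fubini_integral[OF i])
    finally show ?thesis by (simp add: set_lebesgue_integral_def)
  qed
  have meas: "(\<lambda>v. LINT \<omega>:B|M. Z v t \<omega>) \<in> borel_measurable V"
    if t: "t \<in> {0..T}" and B: "B \<in> sets M" for t B
  proof -
    have [measurable]: "(\<lambda>(v, \<omega>). Z v t \<omega>) \<in> borel_measurable (V \<Otimes>\<^sub>M M)" using int[OF t] by auto
    show ?thesis unfolding set_lebesgue_integral_def using B by measurable
  qed
  fix s t B assume s: "s \<in> {0..T}" and t: "t \<in> {s..T}" and B: "B \<in> sets (F s)"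
  have t': "t \<in> {0..T}" using s t by auto
  have BM: "B \<in> sets M" using B sub[OF s] by (auto simp: subalgebra_def)
  show "(LINT \<omega>:B|M. X t \<omega>) = (LINT \<omega>:B|M. X s \<omega>)"
    unfolding swap[OF t' BM] swap[OF s BM]
    by (rule integral_cong_AE[OF meas[OF t' BM] meas[OF s BM] mart[OF s t B]])
qed

section \<open>Product integrals and integrals over time\<close>

lemma integrable_pair_mult:
  fixes f :: "'a \<Rightarrow> real" and g :: "'b \<Rightarrow> real"
  assumes "sigma_finite_measure M1" "sigma_finite_measure M2" "integrable M1 f" "integrable M2 g"
  shows "integrable (M1 \<Otimes>\<^sub>M M2) (\<lambda>z. f (fst z) * g (snd z))"
    and "(LINT z|(M1 \<Otimes>\<^sub>M M2). f (fst z) * g (snd z)) = (LINT x|M1. f x) * (LINT z|M2. g z)"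
proof -
  interpret M1: sigma_finite_measure M1 by fact
  interpret M2: sigma_finite_measure M2 by fact
  interpret pair_sigma_finite M1 M2 ..
  note [measurable] = borel_measurable_integrable[OF assms(3)] borel_measurable_integrable[OF assms(4)]
  show i: "integrable (M1 \<Otimes>\<^sub>M M2) (\<lambda>z. f (fst z) * g (snd z))"
    by (rule Fubini_integrable) (use assms(3,4) in \<open>auto simp: abs_mult\<close>)
  from integral_fst'[OF i] show "(LINT z|(M1 \<Otimes>\<^sub>M M2). f (fst z) * g (snd z)) = (LINT x|M1. f x) * (LINT z|M2. g z)"
    by simp
qed

lemma Lipschitz_finite_variation:
  assumes "\<And>s t. 0 \<le> s \<Longrightarrow> s \<le> t \<Longrightarrow> t \<le> T \<Longrightarrow> \<bar>f t - f s\<bar> \<le> C * (t - s)"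
  shows "finite_variation T f"
  unfolding finite_variation_def
proof (intro exI[of _ "\<bar>C\<bar> * T"] allI impI)
  fix n :: nat and p :: "nat \<Rightarrow> real"
  assume p: "mono_on {..n} p \<and> p ` {..n} \<subseteq> {0..T}"
  have ran: "p i \<in> {0..T}" if "i \<le> n" for i using p that by blast
  have "(\<Sum>i<n. \<bar>f (p (Suc i)) - f (p i)\<bar>) \<le> (\<Sum>i<n. \<bar>C\<bar> * (p (Suc i) - p i))"
  proof (rule sum_mono)
    fix i assume i: "i \<in> {..<n}"
    then have le: "p i \<le> p (Suc i)" using p by (auto simp: mono_on_def)
    have "p i \<in> {0..T}" "p (Suc i) \<in> {0..T}" using i by (auto intro!: ran simp del: atLeastAtMost_iff)
    then have "\<bar>f (p (Suc i)) - f (p i)\<bar> \<le> C * (p (Suc i) - p i)" using assms le by auto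
    also have "\<dots> \<le> \<bar>C\<bar> * (p (Suc i) - p i)" using le by (intro mult_right_mono) auto
    finally show "\<bar>f (p (Suc i)) - f (p i)\<bar> \<le> \<bar>C\<bar> * (p (Suc i) - p i)" .
  qed
  also have "\<dots> = \<bar>C\<bar> * (p n - p 0)"
    by (simp add: sum_distrib_left[symmetric] sum_lessThan_telescope)
  also have "\<dots> \<le> \<bar>C\<bar> * T"
  proof (rule mult_left_mono)
    have "p n \<in> {0..T}" "p 0 \<in> {0..T}" by (simp_all add: ran del: atLeastAtMost_iff)
    then show "p n - p 0 \<le> T" by auto
  qed simp
  finally show "(\<Sum>i<n. \<bar>f (p (Suc i)) - f (p i)\<bar>) \<le> \<bar>C\<bar> * T" .
qed

lemma Lipschitz_continuous_on_interval:
  fixes f :: "real \<Rightarrow> real"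
  assumes "\<And>s t. 0 \<le> s \<Longrightarrow> s \<le> t \<Longrightarrow> t \<le> T \<Longrightarrow> \<bar>f t - f s\<bar> \<le> C * (t - s)"
  shows "continuous_on {0..T} f"
proof -
  have "\<bar>C\<bar>-lipschitz_on {0..T} f"
  proof (rule lipschitz_onI)
    fix s t assume "s \<in> {0..T}" "t \<in> {0..T}"
    then have "\<bar>f t - f s\<bar> \<le> C * \<bar>t - s\<bar>"
      using assms[of s t] assms[of t s] by (cases "s \<le> t") (auto simp: abs_minus_commute)
    also have "\<dots> \<le> \<bar>C\<bar> * \<bar>t - s\<bar>" by (intro mult_right_mono) auto
    finally show "dist (f s) (f t) \<le> \<bar>C\<bar> * dist s t"
      by (simp add: dist_real_def abs_minus_commute)
  qed simp
  then show ?thesis by (rule lipschitz_on_continuous_on)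
qed

abbreviation time_lebesgue :: "real \<Rightarrow> real measure" where
  "time_lebesgue t \<equiv> restrict_space lborel {0..t}"

lemma finite_measure_time: "finite_measure (time_lebesgue t)"
  by (intro finite_measureI) (simp add: emeasure_restrict_space emeasure_lborel_Icc_eq)

lemma AE_time_ne: "AE s in time_lebesgue t. s \<noteq> c"
  using AE_lborel_singleton[of c] by (subst AE_restrict_space_iff) auto

lemma integral_time_Lipschitz:
  assumes g: "integrable (time_lebesgue T) g" and C: "\<And>s. 0 < s \<Longrightarrow> s \<le> T \<Longrightarrow> \<bar>g s\<bar> \<le> C"
    and st: "0 \<le> s" "s \<le> t" "t \<le> T"
  shows "\<bar>(LINT r|time_lebesgue t. g r) - (LINT r|time_lebesgue s. g r)\<bar> \<le> C * (t - s)"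
proof -
  have gT: "set_integrable lborel {0..T} g"
    using g by (simp add: integrable_restrict_space set_integrable_def)
  have i: "set_integrable lborel {0..t} g" "set_integrable lborel {0..s} g" "set_integrable lborel {s<..t} g"
    by (rule set_integrable_subset[OF gT]; use st in force)+
  have "(LINT r|time_lebesgue t. g r) - (LINT r|time_lebesgue s. g r)
      = (LINT r:{0..t}|lborel. g r) - (LINT r:{0..s}|lborel. g r)"
    by (simp add: integral_restrict_space set_lebesgue_integral_def)
  also have "\<dots> = (LINT r:{s<..t}|lborel. g r)"
  proof -
    have "{0..t} = {0..s} \<union> {s<..t}" "{0..s} \<inter> {s<..t} = {}" using st by auto
    then show ?thesis using set_integral_Un[OF _ i(2,3)] by simp
  qed
  finally have eq: "(LINT r|time_lebesgue t. g r) - (LINT r|time_lebesgue s. g r) = (LINT r:{s<..t}|lborel. g r)" .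
  have "\<bar>LINT r:{s<..t}|lborel. g r\<bar> \<le> (LINT r|lborel. indicator {s<..t} r * C)"
    unfolding set_lebesgue_integral_def
  proof (rule integral_abs_bound[THEN order.trans], rule integral_mono)
    show "integrable lborel (\<lambda>x. \<bar>indicator {s<..t} x *\<^sub>R g x\<bar>)"
      using i(3) unfolding set_integrable_def by (rule integrable_abs)
    show "integrable lborel (\<lambda>r. indicator {s<..t} r * C)" using st by auto
    show "\<bar>indicator {s<..t} x *\<^sub>R g x\<bar> \<le> indicator {s<..t} x * C" for x
      using C[of x] st by (auto simp: indicator_def)
  qed
  also have "\<dots> = C * (t - s)" using st by simp
  finally show ?thesis by (simp add: eq)
qed

section \<open>The coalescing flow\<close>

locale coalescing_flow = prob_space M for M :: "'w measure" +
  fixes T :: real and y :: "real \<Rightarrow> real \<Rightarrow> 'w \<Rightarrow> real"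
  assumes T_pos: "T > 0"
    and random_element: "random_element_D M T y"
    and conditions: "cond_C1_C4 M T y"
    and convention: "pathwise_convention M T y"
begin

abbreviation \<F> :: "real \<Rightarrow> 'w measure" where
  "\<F> \<equiv> natural_filtration M T y"

abbreviation profile :: "real \<Rightarrow> 'w \<Rightarrow> real \<Rightarrow> real" where
  "profile s \<omega> \<equiv> (\<lambda>u. y u s \<omega>)"

lemma path_cadlag: "\<omega> \<in> space M \<Longrightarrow> (\<lambda>u\<in>{0..1}. \<lambda>t\<in>{0..T}. y u t \<omega>) \<in> cadlag_C T"
  using measurable_space[OF random_element[unfolded random_element_D_def]]
  by (simp add: skorokhod_space_def space_measure_of_conv)

lemma y_continuous:
  assumes "\<omega> \<in> space M" "u \<in> {0..1}"
  shows "continuous_on {0..T} (\<lambda>t. y u t \<omega>)"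
  by (rule continuous_on_eq[OF cadlag_C_continuous[OF path_cadlag[OF assms(1)] assms(2)]])
    (use assms(2) in auto)

lemma y_right_continuous:
  assumes "\<omega> \<in> space M" "0 \<le> u" "u < 1" "0 < e"
  shows "\<forall>\<^sub>F v in at_right u. \<forall>t\<in>{0..T}. \<bar>y v t \<omega> - y u t \<omega>\<bar> < e"
proof -
  have "\<forall>\<^sub>F v in at_right u. v < 1 \<and> u < v"
    unfolding eventually_at_right_field using assms by blast
  moreover have "\<forall>\<^sub>F v in at_right u. \<forall>t\<in>{0..T}. \<bar>(\<lambda>u\<in>{0..1}. \<lambda>t\<in>{0..T}. y u t \<omega>) v t - (\<lambda>u\<in>{0..1}. \<lambda>t\<in>{0..T}. y u t \<omega>) u t\<bar> < e"
    by (rule cadlag_C_right[OF path_cadlag]) (use assms T_pos in auto)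
  ultimately show ?thesis
    by eventually_elim (use assms in auto)
qed

lemma y_bounded:
  assumes "\<omega> \<in> space M"
  obtains C where "\<And>u t. u \<in> {0..1} \<Longrightarrow> t \<in> {0..T} \<Longrightarrow> \<bar>y u t \<omega>\<bar> \<le> C"
proof (rule cadlag_C_bounded[OF path_cadlag[OF assms]])
  show "0 \<le> T" using T_pos by simp
  fix C assume C: "\<And>u t. u \<in> {0..1} \<Longrightarrow> t \<in> {0..T} \<Longrightarrow> \<bar>(\<lambda>u\<in>{0..1}. \<lambda>t\<in>{0..T}. y u t \<omega>) u t\<bar> \<le> C"
  show thesis
  proof (rule that)
    fix u t assume "u \<in> {0..1::real}" "t \<in> {0..T}"
    then show "\<bar>y u t \<omega>\<bar> \<le> C" using C[of u t] by simp
  qed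
qed

lemma space_F [simp]: "space (\<F> t) = space M"
  by (simp add: natural_filtration_def space_measure_of_conv)

lemma martingale_y: "u \<in> {0..1} \<Longrightarrow> cont_sq_int_martingale M \<F> T (y u)"
  using conditions by (simp add: cond_C1_C4_def)

lemma subalgebra_F: "t \<in> {0..T} \<Longrightarrow> subalgebra M (\<F> t)"
  using martingale_y[of 0] by (auto simp: cont_sq_int_martingale_def martingale_on_def)

lemma y_adapted:
  assumes "u \<in> {0..1}" "s \<in> {0..T}" "s \<le> t"
  shows "y u s \<in> borel_measurable (\<F> t)"
proof (rule measurableI)
  fix B :: "real set" assume "B \<in> sets borel"
  then have "y u s -` B \<inter> space M \<in>
      {y v s -` B \<inter> space M | v s B. v \<in> {0..1} \<and> s \<in> {0..T} \<and> s \<le> t \<and> B \<in> sets borel}"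
    using assms by blast
  then show "y u s -` B \<inter> space (\<F> t) \<in> sets (\<F> t)"
    unfolding space_F by (subst natural_filtration_def) (subst sets_measure_of, auto)
qed simp

lemma measurable_y:
  assumes "t \<in> {0..T}"
    and "p \<in> borel_measurable N" "\<And>z. z \<in> space N \<Longrightarrow> p z \<in> {0..1}"
    and "q \<in> borel_measurable N" "\<And>z. z \<in> space N \<Longrightarrow> q z \<in> {0..t}"
    and "r \<in> N \<rightarrow>\<^sub>M \<F> t"
  shows "(\<lambda>z. y (p z) (q z) (r z)) \<in> borel_measurable N"
proof (rule measurable_random_field[of t y "\<F> t"])
  show "y u s \<in> borel_measurable (\<F> t)" if "u \<in> {0..1}" "s \<in> {0..t}" for u s
    using that assms(1) by (intro y_adapted) auto
  show "\<forall>\<^sub>F v in at_right u. \<forall>s\<in>{0..t}. \<bar>y v s \<omega> - y u s \<omega>\<bar> < e"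
    if "\<omega> \<in> space (\<F> t)" "0 \<le> u" "u < 1" "0 < e" for \<omega> u e
  proof -
    have "\<forall>\<^sub>F v in at_right u. \<forall>s\<in>{0..T}. \<bar>y v s \<omega> - y u s \<omega>\<bar> < e"
      using that by (intro y_right_continuous) auto
    then show ?thesis by eventually_elim (use assms(1) in auto)
  qed
  show "continuous_on {0..t} (\<lambda>s. y u s \<omega>)" if "\<omega> \<in> space (\<F> t)" "u \<in> {0..1}" for \<omega> u
    using y_continuous[of \<omega> u] that assms(1) by (auto intro: continuous_on_subset)
qed (use assms in auto)

lemma profile_measurable:
  assumes "s \<in> {0..T}" "\<omega> \<in> space M"
  shows "profile s \<omega> \<in> borel_measurable unit_lebesgue"
  using assms by (intro measurable_y[of s]) (auto intro!: unit_borel)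

lemma measurable_kernel:
  assumes t: "t \<in> {0..T}"
    and p: "p \<in> borel_measurable N" "\<And>z. z \<in> space N \<Longrightarrow> p z \<in> {0..1}"
    and p': "p' \<in> borel_measurable N" "\<And>z. z \<in> space N \<Longrightarrow> p' z \<in> {0..1}"
    and q: "q \<in> borel_measurable N" "\<And>z. z \<in> space N \<Longrightarrow> q z \<in> {0..t}"
    and r: "r \<in> N \<rightarrow>\<^sub>M \<F> t"
  shows "(\<lambda>z. level_kernel (profile (q z) (r z)) (p z) (p' z)) \<in> borel_measurable N"
proof -
  interpret U: finite_measure unit_lebesgue by (rule finite_measure_unit)
  have [measurable]: "(\<lambda>z. y (p z) (q z) (r z)) \<in> borel_measurable N"
    "(\<lambda>z. y (p' z) (q z) (r z)) \<in> borel_measurable N"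
    by (rule measurable_y[OF t]; use assms in blast)+
  have 1[measurable]: "(\<lambda>x. y (snd x) (q (fst x)) (r (fst x))) \<in> borel_measurable (N \<Otimes>\<^sub>M unit_lebesgue)"
  proof (rule measurable_y[OF t])
    show "snd \<in> borel_measurable (N \<Otimes>\<^sub>M unit_lebesgue)"
      by (rule measurable_compose[OF measurable_snd unit_borel]) simp
    show "(\<lambda>x. q (fst x)) \<in> borel_measurable (N \<Otimes>\<^sub>M unit_lebesgue)"
      by (rule measurable_compose[OF measurable_fst q(1)])
    show "(\<lambda>x. r (fst x)) \<in> N \<Otimes>\<^sub>M unit_lebesgue \<rightarrow>\<^sub>M \<F> t"
      by (rule measurable_compose[OF measurable_fst r])
  qed (use q(2) in \<open>auto simp: space_pair_measure\<close>)
  have [measurable]: "(\<lambda>x. y (p (fst x)) (q (fst x)) (r (fst x))) \<in> borel_measurable (N \<Otimes>\<^sub>M unit_lebesgue)"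
    by measurable
  have "(\<lambda>z. level_mass (profile (q z) (r z)) (p z)) \<in> borel_measurable N"
    unfolding level_mass_eq_integral
    by (rule U.borel_measurable_lebesgue_integral) (simp add: case_prod_unfold)
  then show ?thesis unfolding level_kernel_def by measurable
qed

lemma coalesced:
  assumes "\<omega> \<in> space M" "u \<in> {0..1}" "v \<in> {0..1}" "0 < r" "r \<le> s" "s \<le> T" "y u r \<omega> = y v r \<omega>"
  shows "y u s \<omega> = y v s \<omega>"
proof -
  have "r \<in> {0<..T}" "s \<in> {r..T}" using assms by auto
  then show ?thesis using convention assms unfolding pathwise_convention_def by blast
qed

lemma profile_finite:
  assumes "0 < s" "s \<le> T" "\<omega> \<in> space M"
  shows "step_function (profile s \<omega>)" "finite (profile s \<omega> ` {0..1})"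
proof -
  show "step_function (profile s \<omega>)" using convention assms by (auto simp: pathwise_convention_def)
  then show "finite (profile s \<omega> ` {0..1})" by (rule step_function_finite_range)
qed

lemma profile_mass_pos:
  assumes "0 < s" "s \<le> T" "\<omega> \<in> space M" "0 \<le> u" "u < 1"
  shows "0 < level_mass (profile s \<omega>) u"
proof (rule level_mass_pos)
  show "(profile s \<omega> \<longlongrightarrow> y u s \<omega>) (at_right u)"
  proof (rule tendstoI)
    fix e :: real assume "0 < e"
    from y_right_continuous[OF assms(3-5) this]
    show "\<forall>\<^sub>F x in at_right u. dist (y x s \<omega>) (y u s \<omega>) < e"
      by eventually_elim (use assms in \<open>auto simp: dist_real_def\<close>)
  qed
qed (use assms profile_finite profile_measurable in auto)

text \<open>By continuity the infimum in the meeting time is attained. If it is \<open>0\<close>, the particles have the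
  same starting point; otherwise they stay together after it. The convention that a pair without
  meeting gets the value \<open>T\<close> is the reason for \<open>s < T\<close>.\<close>

lemma meeting_time_le_iff:
  assumes \<omega>: "\<omega> \<in> space M" "\<And>u. u \<in> {0..1} \<Longrightarrow> y u 0 \<omega> = u"
    and uv: "u \<in> {0..1}" "v \<in> {0..1}" and s: "0 < s" "s < T"
  shows "meeting_time T y u v \<omega> \<le> s \<longleftrightarrow> y u s \<omega> = y v s \<omega>"
proof
  define S where "S = {t \<in> {0..T}. y u t \<omega> = y v t \<omega>}"
  have bdd: "bdd_below (insert T S)" by (intro bdd_belowI[of _ 0]) (use T_pos in \<open>auto simp: S_def\<close>)
  have tau: "meeting_time T y u v \<omega> = Inf (insert T S)" by (simp add: meeting_time_def S_def)
  {
    assume "y u s \<omega> = y v s \<omega>"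
    then have "s \<in> insert T S" using s by (auto simp: S_def)
    then show "meeting_time T y u v \<omega> \<le> s" unfolding tau using bdd by (rule cInf_lower)
  next
    assume le: "meeting_time T y u v \<omega> \<le> s"
    have "closed {t \<in> {0..T}. y u t \<omega> - y v t \<omega> = 0}"
      using y_continuous[OF \<omega>(1)] uv
      by (intro continuous_closed_preimage_constant continuous_on_diff) auto
    then have "closed (insert T S)" by (auto simp: S_def)
    then have "Inf (insert T S) \<in> insert T S" using bdd by (intro closed_contains_Inf) auto
    then have "Inf (insert T S) \<in> S" using le s tau by auto
    then obtain r where r: "0 \<le> r" "r \<le> s" "y u r \<omega> = y v r \<omega>" using le tau by (auto simp: S_def)
    show "y u s \<omega> = y v s \<omega>"
    proof (cases "r = 0")
      case True
      then show ?thesis using r \<omega>(2)[OF uv(1)] \<omega>(2)[OF uv(2)] by auto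
    next
      case False
      then show ?thesis using r s by (intro coalesced[OF \<omega>(1) uv, of r s]) simp_all
    qed
  }
qed

text \<open>By coalescence, the particles that have met \<open>u\<close> up to time \<open>s\<close> are those that are with \<open>u\<close> at
  time \<open>s\<close>, so the integrand of (C4) is determined by the profile at time \<open>s\<close> alone. Its denominator is
  positive, and the quotients in \<open>ennreal\<close> and in the reals agree.\<close>

lemma cluster_kernel_eq:
  assumes \<omega>: "\<omega> \<in> space M" "\<And>u. u \<in> {0..1} \<Longrightarrow> y u 0 \<omega> = u"
    and uv: "0 \<le> u" "u < 1" "v \<in> {0..1}" and s: "0 < s" "s < T"
  shows "indicator {meeting_time T y u v \<omega>..} s / cluster_mass y u s \<omega>
    = ennreal (level_kernel (profile s \<omega>) u v)"
proof -
  have u: "u \<in> {0..1}" using uv by auto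
  have "y x s \<omega> = y u s \<omega>" if "x \<in> {0..1}" "r \<in> {0..s}" "y x r \<omega> = y u r \<omega>" for x r
  proof (cases "r = 0")
    case True
    then show ?thesis using that \<omega>(2)[OF u] \<omega>(2)[OF that(1)] by auto
  next
    case False
    then show ?thesis using that s by (intro coalesced[OF \<omega>(1) that(1) u, of r s]) simp_all
  qed
  then have set: "{x \<in> {0..1}. \<exists>r\<in>{0..s}. y x r \<omega> = y u r \<omega>} = level_set (profile s \<omega>) u"
    using s by (fastforce simp: level_set_def)
  have "cluster_mass y u s \<omega> = emeasure unit_lebesgue (level_set (profile s \<omega>) u)"
    unfolding cluster_mass_def set by (subst emeasure_restrict_space) (auto simp: level_set_def)
  also have "\<dots> = ennreal (level_mass (profile s \<omega>) u)"
    unfolding level_mass_def by (rule finite_measure.emeasure_eq_measure[OF finite_measure_unit])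
  finally have mass: "cluster_mass y u s \<omega> = ennreal (level_mass (profile s \<omega>) u)" .
  have pos: "0 < level_mass (profile s \<omega>) u" using profile_mass_pos \<omega> uv s by auto
  show ?thesis
  proof (cases "y u s \<omega> = y v s \<omega>")
    case True
    then have "meeting_time T y u v \<omega> \<le> s" using meeting_time_le_iff[OF \<omega> u uv(3) s] by simp
    then show ?thesis
      using True pos divide_ennreal[of 1 "level_mass (profile s \<omega>) u"] by (simp add: mass level_kernel_def)
  next
    case False
    then have "\<not> meeting_time T y u v \<omega> \<le> s" using meeting_time_le_iff[OF \<omega> u uv(3) s] by simp
    then show ?thesis using False by (simp add: level_kernel_def)
  qed
qed

end

section \<open>The pairing with a square integrable function\<close>

locale coalescing_flow_L2 = coalescing_flow M T y for M :: "'w measure" and T y +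
  fixes a :: "real \<Rightarrow> real"
  assumes a_L2: "a \<in> L2_01"
begin

sublocale U: finite_measure unit_lebesgue by (rule finite_measure_unit)
sublocale UU: pair_sigma_finite unit_lebesgue unit_lebesgue ..
sublocale UM: pair_sigma_finite unit_lebesgue M ..
sublocale UUM: pair_sigma_finite "unit_lebesgue \<Otimes>\<^sub>M unit_lebesgue" M ..

lemma a_measurable [measurable]: "a \<in> borel_measurable unit_lebesgue"
  using a_L2 by (simp add: L2_01_def)

lemma a_integrable: "integrable unit_lebesgue a"
  by (rule L2_integrable[OF a_L2])

definition pairing :: "real \<Rightarrow> 'w \<Rightarrow> real" where
  "pairing t \<omega> = inner_L2 (\<lambda>u. y u t \<omega>) a"

text \<open>Almost surely it dominates all particles at time \<open>t\<close>, by monotonicity in \<open>u\<close>.\<close>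

definition envelope :: "real \<Rightarrow> 'w \<Rightarrow> real" where
  "envelope t \<omega> = \<bar>y 0 t \<omega>\<bar> + \<bar>y 1 t \<omega>\<bar>"

lemma AE_y_le_envelope: "AE \<omega> in M. \<forall>u\<in>{0..1}. \<forall>t\<in>{0..T}. \<bar>y u t \<omega>\<bar> \<le> envelope t \<omega>"
proof -
  have "AE \<omega> in M. \<forall>u\<in>{0..1}. \<forall>v\<in>{0..1}. u < v \<longrightarrow> (\<forall>t\<in>{0..T}. y u t \<omega> \<le> y v t \<omega>)"
    using conditions by (simp add: cond_C1_C4_def)
  then show ?thesis
  proof eventually_elim
    case (elim \<omega>)
    show ?case
    proof (intro ballI)
      fix u t :: real assume u: "u \<in> {0..1}" and t: "t \<in> {0..T}"
      have "y 0 t \<omega> \<le> y u t \<omega>" using elim u t by (cases "u = 0") auto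
      moreover have "y u t \<omega> \<le> y 1 t \<omega>" using elim u t by (cases "u = 1") auto
      ultimately show "\<bar>y u t \<omega>\<bar> \<le> envelope t \<omega>" by (auto simp: envelope_def)
    qed
  qed
qed

lemma envelope_integrable:
  assumes t: "t \<in> {0..T}"
  shows "integrable M (envelope t)" "integrable M (\<lambda>\<omega>. (envelope t \<omega>)\<^sup>2)"
proof -
  have i: "integrable M (y u t)" "integrable M (\<lambda>\<omega>. (y u t \<omega>)\<^sup>2)" if "u \<in> {0..1}" for u
    using martingale_y[OF that] t by (auto simp: cont_sq_int_martingale_def martingale_on_def)
  show envelope: "integrable M (envelope t)" unfolding envelope_def using i(1)[of 0] i(1)[of 1] by auto
  show "integrable M (\<lambda>\<omega>. (envelope t \<omega>)\<^sup>2)"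
  proof (rule Bochner_Integration.integrable_bound[of _ "\<lambda>\<omega>. 2 * (y 0 t \<omega>)\<^sup>2 + 2 * (y 1 t \<omega>)\<^sup>2"])
    show "integrable M (\<lambda>\<omega>. 2 * (y 0 t \<omega>)\<^sup>2 + 2 * (y 1 t \<omega>)\<^sup>2)"
      using i(2)[of 0] i(2)[of 1] by auto
    have "(\<bar>x\<bar> + \<bar>z\<bar>)\<^sup>2 \<le> 2 * x\<^sup>2 + 2 * z\<^sup>2" for x z :: real
      using zero_le_power2[of "\<bar>x\<bar> - \<bar>z\<bar>"] by (simp add: power2_sum power2_diff)
    then show "AE \<omega> in M. norm ((envelope t \<omega>)\<^sup>2) \<le> norm (2 * (y 0 t \<omega>)\<^sup>2 + 2 * (y 1 t \<omega>)\<^sup>2)"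
      by (intro AE_I2) (simp add: envelope_def)
  qed (use envelope in simp)
qed

lemma measurable_into_filtration: "t \<in> {0..T} \<Longrightarrow> f \<in> N \<rightarrow>\<^sub>M M \<Longrightarrow> f \<in> N \<rightarrow>\<^sub>M \<F> t"
  using subalgebra_F[of t] by (auto simp: subalgebra_def measurable_def)

lemma y_joint_measurable:
  assumes "t \<in> {0..T}"
  shows "(\<lambda>z. y (fst z) t (snd z)) \<in> borel_measurable (unit_lebesgue \<Otimes>\<^sub>M \<F> t)"
  using assms
  by (intro measurable_y[of t] measurable_compose[OF measurable_fst unit_borel])
    (auto simp: space_pair_measure)

lemma borel_measurable_pair_filtrationD:
  "t \<in> {0..T} \<Longrightarrow> f \<in> borel_measurable (V \<Otimes>\<^sub>M \<F> t) \<Longrightarrow> f \<in> borel_measurable (V \<Otimes>\<^sub>M M)"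
proof -
  assume t: "t \<in> {0..T}" and f: "f \<in> borel_measurable (V \<Otimes>\<^sub>M \<F> t)"
  have "(\<lambda>z. (fst z, snd z)) \<in> V \<Otimes>\<^sub>M M \<rightarrow>\<^sub>M V \<Otimes>\<^sub>M \<F> t"
    by (intro measurable_Pair measurable_fst measurable_into_filtration[OF t] measurable_snd)
  from measurable_compose[OF this f] show ?thesis by simp
qed

lemma integrable_ya:
  assumes t: "t \<in> {0..T}" and \<omega>: "\<omega> \<in> space M"
  shows "integrable unit_lebesgue (\<lambda>u. y u t \<omega> * a u)"
proof -
  obtain C where C: "\<And>u t. u \<in> {0..1} \<Longrightarrow> t \<in> {0..T} \<Longrightarrow> \<bar>y u t \<omega>\<bar> \<le> C" using y_bounded[OF \<omega>] by blast
  show ?thesis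
  proof (rule Bochner_Integration.integrable_bound[of _ "\<lambda>u. C * a u"])
    show "integrable unit_lebesgue (\<lambda>u. C * a u)" using a_integrable by simp
    show "(\<lambda>u. y u t \<omega> * a u) \<in> borel_measurable unit_lebesgue"
      using profile_measurable[OF t \<omega>] by simp
    show "AE u in unit_lebesgue. norm (y u t \<omega> * a u) \<le> norm (C * a u)"
      using C[OF _ t] by (intro AE_I2) (force simp: abs_mult intro!: mult_right_mono)
  qed
qed

lemma martingale_pairing: "martingale_on M \<F> T pairing"
proof (rule martingale_on_mixture[where V=unit_lebesgue and Z="\<lambda>u t \<omega>. y u t \<omega> * a u"])
  show "prob_space M" by (rule prob_space_axioms)
  show "sigma_finite_measure unit_lebesgue" by (rule U.sigma_finite_measure_axioms)
  show "subalgebra M (\<F> t)" if "t \<in> {0..T}" for t using that by (rule subalgebra_F)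
  show adapted: "(\<lambda>(u, \<omega>). y u t \<omega> * a u) \<in> borel_measurable (unit_lebesgue \<Otimes>\<^sub>M \<F> t)" if "t \<in> {0..T}" for t
    using y_joint_measurable[OF that] unfolding case_prod_unfold by measurable
  show "integrable (unit_lebesgue \<Otimes>\<^sub>M M) (\<lambda>(u, \<omega>). y u t \<omega> * a u)" if t: "t \<in> {0..T}" for t
  proof (rule Bochner_Integration.integrable_bound)
    show "integrable (unit_lebesgue \<Otimes>\<^sub>M M) (\<lambda>z. a (fst z) * envelope t (snd z))"
      by (intro integrable_pair_mult U.sigma_finite_measure_axioms sigma_finite_measure_axioms
        a_integrable envelope_integrable t)
    show m: "(\<lambda>(u, \<omega>). y u t \<omega> * a u) \<in> borel_measurable (unit_lebesgue \<Otimes>\<^sub>M M)"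
      by (rule borel_measurable_pair_filtrationD[OF t adapted[OF t]])
    have [measurable]: "(\<lambda>z. y (fst z) t (snd z)) \<in> borel_measurable (unit_lebesgue \<Otimes>\<^sub>M M)"
      by (rule borel_measurable_pair_filtrationD[OF t y_joint_measurable[OF t]])
    have [measurable]: "envelope t \<in> borel_measurable M" using envelope_integrable[OF t] by auto
    show "AE z in unit_lebesgue \<Otimes>\<^sub>M M. norm (case z of (u, \<omega>) \<Rightarrow> y u t \<omega> * a u) \<le> norm (a (fst z) * envelope t (snd z))"
    proof (rule UM.AE_pair_measure)
      show "{z \<in> space (unit_lebesgue \<Otimes>\<^sub>M M). norm (case z of (u, \<omega>) \<Rightarrow> y u t \<omega> * a u) \<le> norm (a (fst z) * envelope t (snd z))}
        \<in> sets (unit_lebesgue \<Otimes>\<^sub>M M)"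
        unfolding case_prod_unfold by measurable
      show "AE u in unit_lebesgue. AE \<omega> in M. norm (case (u, \<omega>) of (u, \<omega>) \<Rightarrow> y u t \<omega> * a u)
        \<le> norm (a (fst (u, \<omega>)) * envelope t (snd (u, \<omega>)))"
      proof (rule AE_I2)
        fix u assume "u \<in> space unit_lebesgue"
        then have u: "u \<in> {0..1}" by simp
        show "AE \<omega> in M. norm (case (u, \<omega>) of (u, \<omega>) \<Rightarrow> y u t \<omega> * a u)
          \<le> norm (a (fst (u, \<omega>)) * envelope t (snd (u, \<omega>)))"
          using AE_y_le_envelope
        proof eventually_elim
          case (elim \<omega>)
          then have "\<bar>y u t \<omega>\<bar> \<le> envelope t \<omega>" using u t by blast
          then have "\<bar>a u\<bar> * \<bar>y u t \<omega>\<bar> \<le> \<bar>a u\<bar> * \<bar>envelope t \<omega>\<bar>" by (intro mult_left_mono) auto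
          then show ?case by (simp add: abs_mult mult.commute)
        qed
      qed
    qed
  qed
  show "AE u in unit_lebesgue. (LINT \<omega>:B|M. y u t \<omega> * a u) = (LINT \<omega>:B|M. y u s \<omega> * a u)"
    if "s \<in> {0..T}" "t \<in> {s..T}" "B \<in> sets (\<F> s)" for s t B
  proof (rule AE_I2)
    fix u assume "u \<in> space unit_lebesgue"
    then have "martingale_on M \<F> T (y u)" using martingale_y[of u] by (simp add: cont_sq_int_martingale_def)
    then have "(LINT \<omega>:B|M. y u t \<omega>) = (LINT \<omega>:B|M. y u s \<omega>)"
      unfolding martingale_on_iff_set_integral[OF prob_space_axioms] using that by blast
    then show "(LINT \<omega>:B|M. y u t \<omega> * a u) = (LINT \<omega>:B|M. y u s \<omega> * a u)" by simp
  qed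
qed (simp add: pairing_def inner_L2_def)

lemma pairing_bound: "AE \<omega> in M. \<forall>t\<in>{0..T}. \<bar>pairing t \<omega>\<bar> \<le> envelope t \<omega> * (LINT u|unit_lebesgue. \<bar>a u\<bar>)"
  using AE_y_le_envelope AE_space
proof eventually_elim
  case (elim \<omega>)
  show ?case
  proof
    fix t assume t: "t \<in> {0..T}"
    have "\<bar>pairing t \<omega>\<bar> \<le> (LINT u|unit_lebesgue. \<bar>y u t \<omega> * a u\<bar>)"
      unfolding pairing_def inner_L2_def by (rule integral_abs_bound)
    also have "\<dots> \<le> (LINT u|unit_lebesgue. envelope t \<omega> * \<bar>a u\<bar>)"
    proof (rule integral_mono)
      show "integrable unit_lebesgue (\<lambda>u. \<bar>y u t \<omega> * a u\<bar>)" using integrable_ya[OF t] elim by auto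
      show "integrable unit_lebesgue (\<lambda>u. envelope t \<omega> * \<bar>a u\<bar>)" using a_integrable by auto
      show "\<bar>y u t \<omega> * a u\<bar> \<le> envelope t \<omega> * \<bar>a u\<bar>" if "u \<in> space unit_lebesgue" for u
        using elim(1) that t by (auto simp: abs_mult intro!: mult_right_mono)
    qed
    finally show "\<bar>pairing t \<omega>\<bar> \<le> envelope t \<omega> * (LINT u|unit_lebesgue. \<bar>a u\<bar>)" by simp
  qed
qed

lemma pairing_continuous:
  assumes \<omega>: "\<omega> \<in> space M"
  shows "continuous_on {0..T} (\<lambda>t. pairing t \<omega>)"
  unfolding continuous_on_sequentially
proof (intro allI ballI impI)
  fix s t assume t: "t \<in> {0..T}" and s: "(\<forall>n. s n \<in> {0..T}) \<and> s \<longlonglongrightarrow> t"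
  obtain C where C: "\<And>u t. u \<in> {0..1} \<Longrightarrow> t \<in> {0..T} \<Longrightarrow> \<bar>y u t \<omega>\<bar> \<le> C" using y_bounded[OF \<omega>] by blast
  have "(\<lambda>n. LINT u|unit_lebesgue. y u (s n) \<omega> * a u) \<longlonglongrightarrow> (LINT u|unit_lebesgue. y u t \<omega> * a u)"
  proof (rule integral_dominated_convergence[of _ _ _ "\<lambda>u. C * \<bar>a u\<bar>"])
    show "(\<lambda>u. y u t \<omega> * a u) \<in> borel_measurable unit_lebesgue"
      using profile_measurable[OF t \<omega>] by simp
    show "(\<lambda>u. y u (s n) \<omega> * a u) \<in> borel_measurable unit_lebesgue" for n
      using profile_measurable[of "s n", OF _ \<omega>] s by simp
    show "integrable unit_lebesgue (\<lambda>u. C * \<bar>a u\<bar>)" using a_integrable by auto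
    show "AE u in unit_lebesgue. (\<lambda>n. y u (s n) \<omega> * a u) \<longlonglongrightarrow> y u t \<omega> * a u"
    proof (rule AE_I2)
      fix u assume "u \<in> space unit_lebesgue"
      then have "continuous_on {0..T} (\<lambda>t. y u t \<omega>)" using \<omega> by (intro y_continuous) auto
      then have "(\<lambda>n. y u (s n) \<omega>) \<longlonglongrightarrow> y u t \<omega>"
        by (rule continuous_on_tendsto_compose) (use s t in auto)
      then show "(\<lambda>n. y u (s n) \<omega> * a u) \<longlonglongrightarrow> y u t \<omega> * a u" by (intro tendsto_intros)
    qed
    show "AE u in unit_lebesgue. norm (y u (s n) \<omega> * a u) \<le> C * \<bar>a u\<bar>" for n
      using C s by (intro AE_I2) (auto simp: abs_mult intro!: mult_right_mono)
  qed
  then show "((\<lambda>t. pairing t \<omega>) \<circ> s) \<longlonglongrightarrow> pairing t \<omega>" by (simp add: o_def pairing_def inner_L2_def)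
qed

lemma cont_sq_int_martingale_pairing: "cont_sq_int_martingale M \<F> T pairing"
  unfolding cont_sq_int_martingale_def
proof (intro conjI martingale_pairing ballI pairing_continuous)
  fix t assume t: "t \<in> {0..T}"
  let ?c = "LINT u|unit_lebesgue. \<bar>a u\<bar>"
  have [measurable]: "pairing t \<in> borel_measurable M"
    using martingale_pairing t by (auto simp: martingale_on_def)
  show "integrable M (\<lambda>\<omega>. (pairing t \<omega>)\<^sup>2)"
  proof (rule Bochner_Integration.integrable_bound[of _ "\<lambda>\<omega>. (envelope t \<omega>)\<^sup>2 * ?c\<^sup>2"])
    show "integrable M (\<lambda>\<omega>. (envelope t \<omega>)\<^sup>2 * ?c\<^sup>2)" using envelope_integrable[OF t] by simp
    show "AE \<omega> in M. norm ((pairing t \<omega>)\<^sup>2) \<le> norm ((envelope t \<omega>)\<^sup>2 * ?c\<^sup>2)"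
      using pairing_bound
    proof eventually_elim
      case (elim \<omega>)
      then have "\<bar>pairing t \<omega>\<bar> \<le> envelope t \<omega> * ?c" using t by blast
      from power_mono[OF this abs_ge_zero, of 2] show ?case by (simp add: power_mult_distrib)
    qed
  qed simp
qed

section \<open>The quadratic variation of the pairing\<close>

abbreviation UU where "UU \<equiv> unit_lebesgue \<Otimes>\<^sub>M unit_lebesgue"

text \<open>The density of the joint quadratic variation of the particles \<open>fst z\<close> and \<open>snd z\<close>, and its
  integral over \<open>[0,t]\<close>.\<close>

definition merge_rate :: "real \<Rightarrow> 'w \<Rightarrow> real \<times> real \<Rightarrow> real" where
  "merge_rate s \<omega> z = level_kernel (profile s \<omega>) (fst z) (snd z)"

definition merge_integral :: "real \<Rightarrow> 'w \<Rightarrow> real \<times> real \<Rightarrow> real" where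
  "merge_integral t \<omega> z = (LINT s|time_lebesgue t. merge_rate s \<omega> z)"

text \<open>The squared norm of the projection of \<open>a\<close> at a time \<open>s > 0\<close>, in a form without the choice operator, so
  that it is visibly measurable in \<open>s\<close> and \<open>\<omega>\<close>.\<close>

definition energy :: "real \<Rightarrow> 'w \<Rightarrow> real" where
  "energy s \<omega> = inner_L2 a (level_average (profile s \<omega>) a)"

definition bracket :: "real \<Rightarrow> 'w \<Rightarrow> real" where
  "bracket t \<omega> = (LINT s|time_lebesgue t. energy s \<omega>)"

definition weight :: "real \<times> real \<Rightarrow> real" where
  "weight z = a (fst z) * a (snd z)"

lemma weight_measurable [measurable]: "weight \<in> borel_measurable UU"
  unfolding weight_def by measurable

lemma merge_rate_nonneg: "0 \<le> merge_rate s \<omega> z"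
  by (simp add: merge_rate_def level_kernel_nonneg)

lemma merge_rate_measurable:
  assumes t: "t \<in> {0..T}"
    and p: "p \<in> N \<rightarrow>\<^sub>M UU"
    and q: "q \<in> N \<rightarrow>\<^sub>M time_lebesgue t"
    and r: "r \<in> N \<rightarrow>\<^sub>M \<F> t"
  shows "(\<lambda>x. merge_rate (q x) (r x) (p x)) \<in> borel_measurable N"
  unfolding merge_rate_def
proof (rule measurable_kernel[OF t _ _ _ _ _ _ r])
  have id: "(\<lambda>x. x) \<in> borel_measurable unit_lebesgue" by (rule unit_borel) simp
  show "(\<lambda>x. fst (p x)) \<in> borel_measurable N" "(\<lambda>x. snd (p x)) \<in> borel_measurable N"
    by (rule measurable_compose[OF measurable_compose[OF p measurable_fst] id]
             measurable_compose[OF measurable_compose[OF p measurable_snd] id])+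
  show "q \<in> borel_measurable N"
    using measurable_compose[OF q, of "\<lambda>x. x" borel] by (simp add: measurable_restrict_space1)
  fix x assume x: "x \<in> space N"
  show "fst (p x) \<in> {0..1}" "snd (p x) \<in> {0..1}"
    using measurable_space[OF p x] by (auto simp: space_pair_measure)
  show "q x \<in> {0..t}" using measurable_space[OF q x] by (simp add: space_restrict_space)
qed

lemma norm_pr_eq_energy:
  assumes s: "0 < s" "s \<le> T" and \<omega>: "\<omega> \<in> space M"
  shows "(norm_L2 (pr_L2 (profile s \<omega>) a))\<^sup>2 = energy s \<omega>" "0 \<le> energy s \<omega>" "energy s \<omega> \<le> inner_L2 a a"
proof -
  have "profile s \<omega> \<in> borel_measurable unit_lebesgue" using s \<omega> by (intro profile_measurable) auto
  note proj = level_average_projection[OF profile_finite(2)[OF s \<omega>] this a_L2]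
  show "(norm_L2 (pr_L2 (profile s \<omega>) a))\<^sup>2 = energy s \<omega>" "0 \<le> energy s \<omega>" "energy s \<omega> \<le> inner_L2 a a"
    unfolding energy_def using norm_pr_L2_eq[OF a_L2 proj(1) proj(2)] by auto
qed

lemma nn_integral_weighted_merge_rate_le:
  assumes t: "t \<in> {0..T}" and \<omega>: "\<omega> \<in> space M"
  shows "(\<integral>\<^sup>+s. \<integral>\<^sup>+z. ennreal (\<bar>weight z\<bar> * merge_rate s \<omega> z) \<partial>UU \<partial>time_lebesgue t) \<le> ennreal (inner_L2 a a * t)"
proof -
  \<comment> \<open>At time \<open>0\<close> the profile need not be a step function, but one instant is negligible.\<close>
  have "AE s in time_lebesgue t. (\<integral>\<^sup>+z. ennreal (\<bar>weight z\<bar> * merge_rate s \<omega> z) \<partial>UU) \<le> ennreal (inner_L2 a a)"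
    using AE_time_ne[where t=t and c=0] AE_space
  proof eventually_elim
    case (elim s)
    then have s: "0 < s" "s \<le> T" "s \<in> {0..t}" "s \<in> {0..T}" using t by (auto simp: space_restrict_space)
    have "(\<lambda>z. merge_rate s \<omega> z) \<in> borel_measurable UU"
      by (rule merge_rate_measurable[OF t]) (use s t \<omega> in \<open>auto simp: space_restrict_space\<close>)
    then have "(\<lambda>z. ennreal (\<bar>weight z\<bar> * merge_rate s \<omega> z)) \<in> borel_measurable UU" by measurable
    from U.nn_integral_fst[OF this]
    have "(\<integral>\<^sup>+z. ennreal (\<bar>weight z\<bar> * merge_rate s \<omega> z) \<partial>UU)
      = (\<integral>\<^sup>+u. \<integral>\<^sup>+v. ennreal (\<bar>a u * a v\<bar> * level_kernel (profile s \<omega>) u v) \<partial>unit_lebesgue \<partial>unit_lebesgue)"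
      by (simp add: weight_def merge_rate_def)
    also have "\<dots> \<le> ennreal (inner_L2 a a)"
      by (rule nn_integral_level_kernel_le[OF profile_finite(2)[OF s(1,2) \<omega>] profile_measurable[OF s(4) \<omega>] a_L2])
    finally show ?case .
  qed
  then have "(\<integral>\<^sup>+s. \<integral>\<^sup>+z. ennreal (\<bar>weight z\<bar> * merge_rate s \<omega> z) \<partial>UU \<partial>time_lebesgue t)
    \<le> (\<integral>\<^sup>+s. ennreal (inner_L2 a a) \<partial>time_lebesgue t)"
    by (rule nn_integral_mono_AE)
  also have "\<dots> = ennreal (inner_L2 a a * t)"
    using t by (simp add: emeasure_restrict_space space_restrict_space ennreal_mult inner_L2_self_nonneg)
  finally show ?thesis .
qed

lemma weighted_merge_rate_measurable:
  assumes t: "t \<in> {0..T}" and \<omega>: "\<omega> \<in> space M"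
  shows "(\<lambda>x. weight (snd x) * merge_rate (fst x) \<omega> (snd x)) \<in> borel_measurable (time_lebesgue t \<Otimes>\<^sub>M UU)"
proof -
  have [measurable]: "(\<lambda>x. merge_rate (fst x) \<omega> (snd x)) \<in> borel_measurable (time_lebesgue t \<Otimes>\<^sub>M UU)"
    by (rule merge_rate_measurable[OF t]) (use \<omega> in auto)
  show ?thesis by measurable
qed

lemma integrable_weighted_merge_rate:
  assumes t: "t \<in> {0..T}" and \<omega>: "\<omega> \<in> space M"
  shows "integrable (time_lebesgue t \<Otimes>\<^sub>M UU) (\<lambda>x. weight (snd x) * merge_rate (fst x) \<omega> (snd x))"
proof (rule integrableI_bounded)
  interpret L: finite_measure "time_lebesgue t" by (rule finite_measure_time)
  interpret LUU: pair_sigma_finite "time_lebesgue t" UU ..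
  have [measurable]: "(\<lambda>x. merge_rate (fst x) \<omega> (snd x)) \<in> borel_measurable (time_lebesgue t \<Otimes>\<^sub>M UU)"
    by (rule merge_rate_measurable[OF t]) (use \<omega> in auto)
  have "(\<integral>\<^sup>+x. ennreal (norm (weight (snd x) * merge_rate (fst x) \<omega> (snd x))) \<partial>(time_lebesgue t \<Otimes>\<^sub>M UU))
    = (\<integral>\<^sup>+s. \<integral>\<^sup>+z. ennreal (\<bar>weight z\<bar> * merge_rate s \<omega> z) \<partial>UU \<partial>time_lebesgue t)"
    by (subst UU.P.nn_integral_fst[symmetric]) (auto simp: abs_mult abs_of_nonneg[OF merge_rate_nonneg])
  also have "\<dots> \<le> ennreal (inner_L2 a a * t)" by (rule nn_integral_weighted_merge_rate_le[OF t \<omega>])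
  also have "\<dots> < \<infinity>" by simp
  finally show "(\<integral>\<^sup>+x. ennreal (norm (weight (snd x) * merge_rate (fst x) \<omega> (snd x))) \<partial>(time_lebesgue t \<Otimes>\<^sub>M UU)) < \<infinity>" .
qed (rule weighted_merge_rate_measurable[OF t \<omega>])

text \<open>Fubini for fixed \<open>\<omega>\<close> turns the time integral of the energy into the mixture of the joint
  quadratic variations.\<close>

lemma bracket_eq_integral:
  assumes t: "t \<in> {0..T}" and \<omega>: "\<omega> \<in> space M"
  shows "bracket t \<omega> = (LINT z|UU. weight z * merge_integral t \<omega> z)" "integrable UU (\<lambda>z. weight z * merge_integral t \<omega> z)"
    "integrable (time_lebesgue t) (\<lambda>s. energy s \<omega>)"
proof -
  interpret L: finite_measure "time_lebesgue t" by (rule finite_measure_time)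
  interpret LUU: pair_sigma_finite "time_lebesgue t" UU ..
  note i = integrable_weighted_merge_rate[OF t \<omega>]
  have AE_G: "AE s in time_lebesgue t. (LINT z|UU. weight z * merge_rate s \<omega> z) = energy s \<omega>"
    using LUU.AE_integrable_fst'[OF i]
  proof eventually_elim
    case (elim s)
    then have "integrable UU (\<lambda>z. weight z * merge_rate s \<omega> z)" by simp
    from UU.integral_fst'[OF this] show ?case
      by (simp add: energy_def inner_level_average weight_def merge_rate_def)
  qed
  have G_meas: "(\<lambda>s. energy s \<omega>) \<in> borel_measurable (time_lebesgue t)"
  proof -
    have [measurable]: "(\<lambda>x. merge_rate (fst (fst x)) \<omega> (snd (fst x), snd x))
        \<in> borel_measurable ((time_lebesgue t \<Otimes>\<^sub>M unit_lebesgue) \<Otimes>\<^sub>M unit_lebesgue)"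
      by (rule merge_rate_measurable[OF t]) (use \<omega> in auto)
    show ?thesis unfolding energy_def inner_level_average
      by (intro U.borel_measurable_lebesgue_integral)
         (simp add: case_prod_unfold merge_rate_def[of _ _ "(_, _)", simplified, symmetric])
  qed
  have int_G: "integrable (time_lebesgue t) (\<lambda>s. LINT z|UU. weight z * merge_rate s \<omega> z)"
    using LUU.integrable_fst'[OF i] by simp
  then show "integrable (time_lebesgue t) (\<lambda>s. energy s \<omega>)"
    by (rule integrable_cong_AE_imp[OF _ G_meas]) (use AE_G in \<open>auto elim: eventually_mono\<close>)
  have "bracket t \<omega> = (LINT s|time_lebesgue t. LINT z|UU. weight z * merge_rate s \<omega> z)"
    unfolding bracket_def by (rule integral_cong_AE) (use G_meas int_G AE_G in \<open>auto elim: eventually_mono\<close>)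
  also have "\<dots> = (LINT z|UU. LINT s|time_lebesgue t. weight z * merge_rate s \<omega> z)"
    by (rule LUU.Fubini_integral[symmetric]) (use i in \<open>simp add: case_prod_unfold\<close>)
  finally show "bracket t \<omega> = (LINT z|UU. weight z * merge_integral t \<omega> z)"
    by (simp add: merge_integral_def)
  have "integrable UU (\<lambda>z. LINT s|time_lebesgue t. weight z * merge_rate s \<omega> z)"
    by (rule LUU.integrable_snd) (use i in \<open>simp add: case_prod_unfold\<close>)
  then show "integrable UU (\<lambda>z. weight z * merge_integral t \<omega> z)" by (simp add: merge_integral_def)
qed

lemma merge_integral_measurable:
  assumes t: "t \<in> {0..T}"
  shows "(\<lambda>x. merge_integral t (snd x) (fst x)) \<in> borel_measurable (UU \<Otimes>\<^sub>M \<F> t)"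
proof -
  interpret L: finite_measure "time_lebesgue t" by (rule finite_measure_time)
  have "(\<lambda>x. merge_rate (snd x) (snd (fst x)) (fst (fst x))) \<in> borel_measurable ((UU \<Otimes>\<^sub>M \<F> t) \<Otimes>\<^sub>M time_lebesgue t)"
    by (rule merge_rate_measurable[OF t]) auto
  then show ?thesis unfolding merge_integral_def
    by (intro L.borel_measurable_lebesgue_integral) (simp add: case_prod_unfold)
qed

lemma integrable_weighted_merge_integral:
  assumes t: "t \<in> {0..T}"
  shows "integrable (UU \<Otimes>\<^sub>M M) (\<lambda>x. weight (fst x) * merge_integral t (snd x) (fst x))"
proof (rule integrableI_bounded)
  interpret L: finite_measure "time_lebesgue t" by (rule finite_measure_time)
  interpret LUU: pair_sigma_finite "time_lebesgue t" UU ..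
  have Jm: "(\<lambda>x. merge_integral t (snd x) (fst x)) \<in> borel_measurable (UU \<Otimes>\<^sub>M M)"
    by (rule borel_measurable_pair_filtrationD[OF t merge_integral_measurable[OF t]])
  then show m[measurable]: "(\<lambda>x. weight (fst x) * merge_integral t (snd x) (fst x)) \<in> borel_measurable (UU \<Otimes>\<^sub>M M)"
    by measurable
  have "(\<integral>\<^sup>+x. ennreal (norm (weight (fst x) * merge_integral t (snd x) (fst x))) \<partial>(UU \<Otimes>\<^sub>M M))
    = (\<integral>\<^sup>+\<omega>. \<integral>\<^sup>+z. ennreal (norm (weight z * merge_integral t \<omega> z)) \<partial>UU \<partial>M)"
    by (subst UUM.nn_integral_snd[symmetric]) auto
  also have "\<dots> \<le> (\<integral>\<^sup>+\<omega>. ennreal (inner_L2 a a * t) \<partial>M)"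
  proof (rule nn_integral_mono)
    fix \<omega> assume \<omega>: "\<omega> \<in> space M"
    note [measurable] = weighted_merge_rate_measurable[OF t \<omega>]
    have "(\<integral>\<^sup>+z. ennreal (norm (weight z * merge_integral t \<omega> z)) \<partial>UU)
      \<le> (\<integral>\<^sup>+z. \<integral>\<^sup>+s. ennreal (\<bar>weight z\<bar> * merge_rate s \<omega> z) \<partial>time_lebesgue t \<partial>UU)"
    proof (rule nn_integral_mono_AE)
      have "AE z in UU. integrable (time_lebesgue t) (\<lambda>s. weight z * merge_rate s \<omega> z)"
        using LUU.AE_integrable_snd[of "\<lambda>s z. weight z * merge_rate s \<omega> z"] integrable_weighted_merge_rate[OF t \<omega>]
        by (simp add: case_prod_unfold)
      then show "AE z in UU. ennreal (norm (weight z * merge_integral t \<omega> z))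
        \<le> (\<integral>\<^sup>+s. ennreal (\<bar>weight z\<bar> * merge_rate s \<omega> z) \<partial>time_lebesgue t)"
      proof eventually_elim
        case (elim z)
        from integral_norm_bound_ennreal[OF this] show ?case
          by (simp add: merge_integral_def abs_mult abs_of_nonneg[OF merge_rate_nonneg])
      qed
    qed
    also have "\<dots> = (\<integral>\<^sup>+s. \<integral>\<^sup>+z. ennreal (\<bar>weight z\<bar> * merge_rate s \<omega> z) \<partial>UU \<partial>time_lebesgue t)"
    proof (rule LUU.Fubini')
      have [measurable]: "(\<lambda>x. merge_rate (fst x) \<omega> (snd x)) \<in> borel_measurable (time_lebesgue t \<Otimes>\<^sub>M UU)"
        by (rule merge_rate_measurable[OF t]) (use \<omega> in auto)
      show "(\<lambda>(s, z). ennreal (\<bar>weight z\<bar> * merge_rate s \<omega> z)) \<in> borel_measurable (time_lebesgue t \<Otimes>\<^sub>M UU)"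
        unfolding case_prod_unfold by measurable
    qed
    also have "\<dots> \<le> ennreal (inner_L2 a a * t)" by (rule nn_integral_weighted_merge_rate_le[OF t \<omega>])
    finally show "(\<integral>\<^sup>+z. ennreal (norm (weight z * merge_integral t \<omega> z)) \<partial>UU) \<le> ennreal (inner_L2 a a * t)" .
  qed
  also have "\<dots> < \<infinity>" by (simp add: emeasure_space_1)
  finally show "(\<integral>\<^sup>+x. ennreal (norm (weight (fst x) * merge_integral t (snd x) (fst x))) \<partial>(UU \<Otimes>\<^sub>M M)) < \<infinity>" .
qed

lemma yy_measurable:
  assumes t: "t \<in> {0..T}"
  shows "(\<lambda>x. y (fst (fst x)) t (snd x) * y (snd (fst x)) t (snd x)) \<in> borel_measurable (UU \<Otimes>\<^sub>M \<F> t)"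
proof -
  have "(\<lambda>x. (fst (fst x), snd x)) \<in> UU \<Otimes>\<^sub>M \<F> t \<rightarrow>\<^sub>M unit_lebesgue \<Otimes>\<^sub>M \<F> t"
    "(\<lambda>x. (snd (fst x), snd x)) \<in> UU \<Otimes>\<^sub>M \<F> t \<rightarrow>\<^sub>M unit_lebesgue \<Otimes>\<^sub>M \<F> t" by measurable
  from this[THEN measurable_compose, OF y_joint_measurable[OF t]] show ?thesis by simp
qed

lemma integrable_weighted_yy:
  assumes t: "t \<in> {0..T}"
  shows "integrable (UU \<Otimes>\<^sub>M M) (\<lambda>x. weight (fst x) * (y (fst (fst x)) t (snd x) * y (snd (fst x)) t (snd x)))"
proof (rule Bochner_Integration.integrable_bound)
  have aa_int: "integrable UU weight"
    unfolding weight_def by (intro integrable_pair_mult U.sigma_finite_measure_axioms a_integrable)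
  show "integrable (UU \<Otimes>\<^sub>M M) (\<lambda>x. weight (fst x) * (envelope t (snd x))\<^sup>2)"
    by (rule integrable_pair_mult[OF _ sigma_finite_measure_axioms aa_int envelope_integrable(2)[OF t]])
       (rule UU.P.sigma_finite_measure_axioms)
  have yy[measurable]: "(\<lambda>x. y (fst (fst x)) t (snd x) * y (snd (fst x)) t (snd x)) \<in> borel_measurable (UU \<Otimes>\<^sub>M M)"
    by (rule borel_measurable_pair_filtrationD[OF t yy_measurable[OF t]])
  show "(\<lambda>x. weight (fst x) * (y (fst (fst x)) t (snd x) * y (snd (fst x)) t (snd x))) \<in> borel_measurable (UU \<Otimes>\<^sub>M M)"
    by measurable
  have [measurable]: "envelope t \<in> borel_measurable M" using envelope_integrable[OF t] by auto
  show "AE x in UU \<Otimes>\<^sub>M M. norm (weight (fst x) * (y (fst (fst x)) t (snd x) * y (snd (fst x)) t (snd x)))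
    \<le> norm (weight (fst x) * (envelope t (snd x))\<^sup>2)"
  proof (rule UUM.AE_pair_measure)
    show "{x \<in> space (UU \<Otimes>\<^sub>M M). norm (weight (fst x) * (y (fst (fst x)) t (snd x) * y (snd (fst x)) t (snd x)))
      \<le> norm (weight (fst x) * (envelope t (snd x))\<^sup>2)} \<in> sets (UU \<Otimes>\<^sub>M M)" by measurable
    show "AE z in UU. AE \<omega> in M. norm (weight (fst (z, \<omega>)) * (y (fst (fst (z, \<omega>))) t (snd (z, \<omega>)) * y (snd (fst (z, \<omega>))) t (snd (z, \<omega>))))
      \<le> norm (weight (fst (z, \<omega>)) * (envelope t (snd (z, \<omega>)))\<^sup>2)"
    proof (rule AE_I2)
      fix z assume "z \<in> space UU"
      then have z: "fst z \<in> {0..1}" "snd z \<in> {0..1}" by (auto simp: space_pair_measure)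
      show "AE \<omega> in M. norm (weight (fst (z, \<omega>)) * (y (fst (fst (z, \<omega>))) t (snd (z, \<omega>)) * y (snd (fst (z, \<omega>))) t (snd (z, \<omega>))))
        \<le> norm (weight (fst (z, \<omega>)) * (envelope t (snd (z, \<omega>)))\<^sup>2)"
        using AE_y_le_envelope
      proof eventually_elim
        case (elim \<omega>)
        then have "\<bar>y (fst z) t \<omega>\<bar> \<le> envelope t \<omega>" "\<bar>y (snd z) t \<omega>\<bar> \<le> envelope t \<omega>" using z t by blast+
        then have "\<bar>y (fst z) t \<omega>\<bar> * \<bar>y (snd z) t \<omega>\<bar> \<le> envelope t \<omega> * envelope t \<omega>"
          by (intro mult_mono) (auto simp: envelope_def)
        then have "\<bar>weight z\<bar> * (\<bar>y (fst z) t \<omega>\<bar> * \<bar>y (snd z) t \<omega>\<bar>) \<le> \<bar>weight z\<bar> * (envelope t \<omega> * envelope t \<omega>)"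
          by (intro mult_left_mono) auto
        then show ?case by (simp add: abs_mult power2_eq_square)
      qed
    qed
  qed
qed

lemma AE_y_start: "AE \<omega> in M. \<forall>u\<in>{0..1}. y u 0 \<omega> = u"
  using conditions by (simp add: cond_C1_C4_def)

text \<open>The compensator given by (C4) agrees almost surely, at all times, with the adapted version
  \<open>merge_integral\<close>, because the two densities coincide except at the times \<open>0\<close> and \<open>T\<close>. The particle
  \<open>u = 1\<close> is excluded because its level may have mass zero.\<close>

lemma set_integral_yy_minus_merge_integral:
  assumes u: "0 \<le> u" "u < 1" and v: "v \<in> {0..1}"
    and s: "s \<in> {0..T}" and t: "t \<in> {s..T}" and B: "B \<in> sets (\<F> s)"
  shows "(LINT \<omega>:B|M. y u t \<omega> * y v t \<omega> - merge_integral t \<omega> (u, v)) = (LINT \<omega>:B|M. y u s \<omega> * y v s \<omega> - merge_integral s \<omega> (u, v))"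
proof -
  have u': "u \<in> {0..1}" using u by auto
  let ?Q = "\<lambda>t \<omega>. \<integral>\<^sup>+ s\<in>{0..t}. (indicator {meeting_time T y u v \<omega>..} s / cluster_mass y u s \<omega>) \<partial>lborel"
  have "joint_qv_eq M \<F> T (y u) (y v) (\<lambda>t \<omega>. enn2ereal (?Q t \<omega>))"
    using conditions u' v unfolding cond_C1_C4_def by blast
  then obtain W where W: "joint_qv M \<F> T (y u) (y v) W"
    "AE \<omega> in M. \<forall>t\<in>{0..T}. ereal (W t \<omega>) = enn2ereal (?Q t \<omega>)"
    unfolding joint_qv_eq_def by blast
  have mart: "martingale_on M \<F> T (\<lambda>t \<omega>. y u t \<omega> * y v t \<omega> - W t \<omega>)"
    using W(1) by (simp add: joint_qv_def)
  have WJ: "AE \<omega> in M. \<forall>t\<in>{0..T}. W t \<omega> = merge_integral t \<omega> (u, v)"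
    using W(2) AE_y_start AE_space
  proof eventually_elim
    case (elim \<omega>)
    show ?case
    proof
      fix t assume t: "t \<in> {0..T}"
      have "?Q t \<omega> = (\<integral>\<^sup>+s. (indicator {meeting_time T y u v \<omega>..} s / cluster_mass y u s \<omega>) \<partial>time_lebesgue t)"
        by (simp add: nn_integral_restrict_space)
      also have "\<dots> = (\<integral>\<^sup>+s. ennreal (merge_rate s \<omega> (u, v)) \<partial>time_lebesgue t)"
      proof (rule nn_integral_cong_AE)
        show "AE s in time_lebesgue t. indicator {meeting_time T y u v \<omega>..} s / cluster_mass y u s \<omega>
          = ennreal (merge_rate s \<omega> (u, v))"
          using AE_time_ne[where t=t and c=0] AE_time_ne[where t=t and c=T] AE_space
        proof eventually_elim
          case (elim s)
          then have "0 < s" "s < T" using t by (auto simp: space_restrict_space)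
          then show ?case unfolding merge_rate_def fst_conv snd_conv
            using \<open>\<omega> \<in> space M\<close> \<open>\<forall>u\<in>{0..1}. y u 0 \<omega> = u\<close> u v
            by (intro cluster_kernel_eq) auto
        qed
      qed
      finally have Q: "?Q t \<omega> = (\<integral>\<^sup>+s. ennreal (merge_rate s \<omega> (u, v)) \<partial>time_lebesgue t)" .
      have "(\<lambda>s. merge_rate s \<omega> (u, v)) \<in> borel_measurable (time_lebesgue t)"
        by (rule merge_rate_measurable[OF t]) (use elim u' v in \<open>auto simp: space_pair_measure\<close>)
      then have "merge_integral t \<omega> (u, v) = enn2real (?Q t \<omega>)"
        unfolding Q merge_integral_def by (intro integral_eq_nn_integral) (auto simp: merge_rate_nonneg)
      also have "\<dots> = real_of_ereal (ereal (W t \<omega>))"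
      proof -
        have "ereal (W t \<omega>) = enn2ereal (?Q t \<omega>)" using elim(1) t by blast
        then show ?thesis by (simp only: enn2real_def)
      qed
      finally show "W t \<omega> = merge_integral t \<omega> (u, v)" by simp
    qed
  qed
  have eq: "(LINT \<omega>:B'|M. y u t \<omega> * y v t \<omega> - merge_integral t \<omega> (u, v)) = (LINT \<omega>:B'|M. y u t \<omega> * y v t \<omega> - W t \<omega>)"
    if t: "t \<in> {0..T}" and B': "B' \<in> sets M" for t B'
    unfolding set_lebesgue_integral_def
  proof (rule integral_cong_AE)
    have "(\<lambda>\<omega>. y u t \<omega> * y v t \<omega> - W t \<omega>) \<in> borel_measurable M"
      using mart t by (auto simp: martingale_on_def)
    then show "(\<lambda>\<omega>. indicator B' \<omega> *\<^sub>R (y u t \<omega> * y v t \<omega> - W t \<omega>)) \<in> borel_measurable M"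
      using B' by measurable
    have [measurable]: "y u t \<in> borel_measurable M" "y v t \<in> borel_measurable M"
      using martingale_y[OF u'] martingale_y[OF v] t
      by (auto simp: cont_sq_int_martingale_def martingale_on_def)
    have "(\<lambda>\<omega>. ((u, v), \<omega>)) \<in> M \<rightarrow>\<^sub>M UU \<Otimes>\<^sub>M M"
      using u' v by (intro measurable_Pair1') (auto simp: space_pair_measure)
    from measurable_compose[OF this borel_measurable_pair_filtrationD[OF t merge_integral_measurable[OF t]]]
    have [measurable]: "(\<lambda>\<omega>. merge_integral t \<omega> (u, v)) \<in> borel_measurable M" by simp
    show "(\<lambda>\<omega>. indicator B' \<omega> *\<^sub>R (y u t \<omega> * y v t \<omega> - merge_integral t \<omega> (u, v))) \<in> borel_measurable M"
      using B' by measurable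
    show "AE \<omega> in M. indicator B' \<omega> *\<^sub>R (y u t \<omega> * y v t \<omega> - merge_integral t \<omega> (u, v)) = indicator B' \<omega> *\<^sub>R (y u t \<omega> * y v t \<omega> - W t \<omega>)"
      using WJ by eventually_elim (use t in simp)
  qed
  have BM: "B \<in> sets M" using B subalgebra_F[OF s] by (auto simp: subalgebra_def)
  have "(LINT \<omega>:B|M. y u t \<omega> * y v t \<omega> - W t \<omega>) = (LINT \<omega>:B|M. y u s \<omega> * y v s \<omega> - W s \<omega>)"
    using mart s t B unfolding martingale_on_iff_set_integral[OF prob_space_axioms] by blast
  then show ?thesis using eq[OF _ BM, of t] eq[OF s BM] s t by simp
qed

lemma pairing_sq:
  assumes t: "t \<in> {0..T}" and \<omega>: "\<omega> \<in> space M"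
  shows "integrable UU (\<lambda>z. weight z * (y (fst z) t \<omega> * y (snd z) t \<omega>))"
    "pairing t \<omega> * pairing t \<omega> = (LINT z|UU. weight z * (y (fst z) t \<omega> * y (snd z) t \<omega>))"
proof -
  note i = integrable_pair_mult[OF U.sigma_finite_measure_axioms U.sigma_finite_measure_axioms
      integrable_ya[OF t \<omega>] integrable_ya[OF t \<omega>]]
  have eq: "weight z * (y (fst z) t \<omega> * y (snd z) t \<omega>) = (y (fst z) t \<omega> * a (fst z)) * (y (snd z) t \<omega> * a (snd z))" for z
    by (simp add: weight_def mult_ac)
  show "integrable UU (\<lambda>z. weight z * (y (fst z) t \<omega> * y (snd z) t \<omega>))" unfolding eq by (rule i(1))
  show "pairing t \<omega> * pairing t \<omega> = (LINT z|UU. weight z * (y (fst z) t \<omega> * y (snd z) t \<omega>))"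
    unfolding eq pairing_def inner_L2_def by (rule i(2)[symmetric])
qed

lemma martingale_pairing_sq_minus_bracket: "martingale_on M \<F> T (\<lambda>t \<omega>. pairing t \<omega> * pairing t \<omega> - bracket t \<omega>)"
proof (rule martingale_on_mixture[where V=UU and
    Z="\<lambda>z t \<omega>. weight z * (y (fst z) t \<omega> * y (snd z) t \<omega>) - weight z * merge_integral t \<omega> z"])
  show "prob_space M" by (rule prob_space_axioms)
  show "sigma_finite_measure UU" by (rule UU.P.sigma_finite_measure_axioms)
  show "subalgebra M (\<F> t)" if "t \<in> {0..T}" for t using that by (rule subalgebra_F)
  show "(\<lambda>(z, \<omega>). weight z * (y (fst z) t \<omega> * y (snd z) t \<omega>) - weight z * merge_integral t \<omega> z) \<in> borel_measurable (UU \<Otimes>\<^sub>M \<F> t)"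
    if "t \<in> {0..T}" for t
    using yy_measurable[OF that] merge_integral_measurable[OF that] unfolding case_prod_unfold by measurable
  show "integrable (UU \<Otimes>\<^sub>M M) (\<lambda>(z, \<omega>). weight z * (y (fst z) t \<omega> * y (snd z) t \<omega>) - weight z * merge_integral t \<omega> z)"
    if "t \<in> {0..T}" for t
    using Bochner_Integration.integrable_diff[OF integrable_weighted_yy[OF that] integrable_weighted_merge_integral[OF that]]
    by (simp add: case_prod_unfold)
  show "pairing t \<omega> * pairing t \<omega> - bracket t \<omega> = (LINT z|UU. weight z * (y (fst z) t \<omega> * y (snd z) t \<omega>) - weight z * merge_integral t \<omega> z)"
    if "t \<in> {0..T}" "\<omega> \<in> space M" for t \<omega>
    using pairing_sq[OF that] bracket_eq_integral[OF that] by simp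
  show "AE z in UU. (LINT \<omega>:B|M. weight z * (y (fst z) t \<omega> * y (snd z) t \<omega>) - weight z * merge_integral t \<omega> z)
      = (LINT \<omega>:B|M. weight z * (y (fst z) s \<omega> * y (snd z) s \<omega>) - weight z * merge_integral s \<omega> z)"
    if "s \<in> {0..T}" "t \<in> {s..T}" "B \<in> sets (\<F> s)" for s t B
  proof -
    have [measurable]: "fst \<in> borel_measurable UU"
      by (rule measurable_compose[OF measurable_fst unit_borel]) simp
    have "AE z in UU. fst z < 1"
      by (rule UU.AE_pair_measure) (use AE_unit_less_one in auto)
    then show ?thesis using AE_space
    proof eventually_elim
      case (elim z)
      then have z: "0 \<le> fst z" "fst z < 1" "snd z \<in> {0..1}" by (auto simp: space_pair_measure)
      have "(LINT \<omega>:B|M. weight z * (y (fst z) t \<omega> * y (snd z) t \<omega> - merge_integral t \<omega> z))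
        = (LINT \<omega>:B|M. weight z * (y (fst z) s \<omega> * y (snd z) s \<omega> - merge_integral s \<omega> z))"
        using set_integral_yy_minus_merge_integral[OF z that] by simp
      then show ?case by (simp only: right_diff_distrib)
    qed
  qed
qed

text \<open>A projection does not increase the norm, so the energy is at most \<open>\<parallel>a\<parallel>\<^sup>2\<close>.\<close>

lemma bracket_Lipschitz:
  assumes \<omega>: "\<omega> \<in> space M" and st: "0 \<le> s" "s \<le> t" "t \<le> T"
  shows "\<bar>bracket t \<omega> - bracket s \<omega>\<bar> \<le> inner_L2 a a * (t - s)"
  unfolding bracket_def
proof (rule integral_time_Lipschitz[OF _ _ st])
  show "integrable (time_lebesgue T) (\<lambda>s. energy s \<omega>)"
    using T_pos by (intro bracket_eq_integral \<omega>) auto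
  show "\<bar>energy r \<omega>\<bar> \<le> inner_L2 a a" if "0 < r" "r \<le> T" for r
    using norm_pr_eq_energy[OF that \<omega>] by simp
qed

text \<open>The mixture representation involves only values of the flow up to time \<open>t\<close>, and it is valid for
  every \<open>\<omega>\<close>.\<close>

lemma bracket_adapted:
  assumes t: "t \<in> {0..T}"
  shows "bracket t \<in> borel_measurable (\<F> t)"
proof -
  have "(\<lambda>x. weight (snd x) * merge_integral t (fst x) (snd x)) \<in> borel_measurable (\<F> t \<Otimes>\<^sub>M UU)"
  proof -
    have "(\<lambda>x. (snd x, fst x)) \<in> \<F> t \<Otimes>\<^sub>M UU \<rightarrow>\<^sub>M UU \<Otimes>\<^sub>M \<F> t" by measurable
    from measurable_compose[OF this merge_integral_measurable[OF t]]
    have [measurable]: "(\<lambda>x. merge_integral t (fst x) (snd x)) \<in> borel_measurable (\<F> t \<Otimes>\<^sub>M UU)" by simp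
    show ?thesis by measurable
  qed
  then have "(\<lambda>\<omega>. LINT z|UU. weight z * merge_integral t \<omega> z) \<in> borel_measurable (\<F> t)"
    by (intro UU.P.borel_measurable_lebesgue_integral) (simp add: case_prod_unfold)
  then show ?thesis using bracket_eq_integral(1)[OF t] by (subst measurable_cong) auto
qed

lemma bracket_eq_integral_norm_pr:
  assumes t: "t \<in> {0..T}" and \<omega>: "\<omega> \<in> space M"
  shows "ereal (bracket t \<omega>) = enn2ereal (\<integral>\<^sup>+ s\<in>{0..t}. ennreal ((norm_L2 (pr_L2 (profile s \<omega>) a))\<^sup>2) \<partial>lborel)"
proof -
  have energy: "AE s in time_lebesgue t. (norm_L2 (pr_L2 (profile s \<omega>) a))\<^sup>2 = energy s \<omega> \<and> 0 \<le> energy s \<omega>"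
    using AE_time_ne[where t=t and c=0] AE_space
  proof eventually_elim
    case (elim s)
    then have "0 < s" "s \<le> T" using t by (auto simp: space_restrict_space)
    then show ?case using norm_pr_eq_energy \<omega> by blast
  qed
  have "(\<integral>\<^sup>+ s\<in>{0..t}. ennreal ((norm_L2 (pr_L2 (profile s \<omega>) a))\<^sup>2) \<partial>lborel)
    = (\<integral>\<^sup>+s. ennreal ((norm_L2 (pr_L2 (profile s \<omega>) a))\<^sup>2) \<partial>time_lebesgue t)"
    by (simp add: nn_integral_restrict_space)
  also have "\<dots> = (\<integral>\<^sup>+s. ennreal (energy s \<omega>) \<partial>time_lebesgue t)"
    by (rule nn_integral_cong_AE) (use energy in \<open>auto elim: eventually_mono\<close>)
  also have "\<dots> = ennreal (bracket t \<omega>)"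
    unfolding bracket_def using energy
    by (intro nn_integral_eq_integral bracket_eq_integral(3)[OF t \<omega>]) (auto elim: eventually_mono)
  finally have eq: "(\<integral>\<^sup>+ s\<in>{0..t}. ennreal ((norm_L2 (pr_L2 (profile s \<omega>) a))\<^sup>2) \<partial>lborel) = ennreal (bracket t \<omega>)" .
  have "0 \<le> bracket t \<omega>"
    unfolding bracket_def using energy by (intro integral_nonneg_AE) (auto elim: eventually_mono)
  then show ?thesis unfolding eq by (simp add: enn2ereal_ennreal)
qed

lemma joint_qv_pairing: "joint_qv M \<F> T pairing pairing bracket"
  unfolding joint_qv_def
proof (intro conjI ballI martingale_pairing_sq_minus_bracket bracket_adapted AE_I2)
  fix \<omega> assume \<omega>: "\<omega> \<in> space M"
  have "AE s in time_lebesgue 0. False"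
    using AE_time_ne[where t=0 and c=0] AE_space by eventually_elim (auto simp: space_restrict_space)
  then show "bracket 0 \<omega> = 0" unfolding bracket_def by (intro integral_eq_zero_AE) (auto elim: eventually_mono)
  show "continuous_on {0..T} (\<lambda>t. bracket t \<omega>)" "finite_variation T (\<lambda>t. bracket t \<omega>)"
    using bracket_Lipschitz[OF \<omega>] by (rule Lipschitz_continuous_on_interval Lipschitz_finite_variation; blast)+
qed

end

theorem lemma3p1:
  fixes M :: "'w measure" and T :: real
    and y :: "real \<Rightarrow> real \<Rightarrow> 'w \<Rightarrow> real" and a :: "real \<Rightarrow> real"
  assumes "prob_space M"
    and "T > 0"
    and "random_element_D M T y"
    and "cond_C1_C4 M T y"
    and "pathwise_convention M T y"
    and "a \<in> L2_01"
  shows "cont_sq_int_martingale M (natural_filtration M T y) T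
           (\<lambda>t \<omega>. inner_L2 (\<lambda>u. y u t \<omega>) a)
       \<and> joint_qv_eq M (natural_filtration M T y) T
           (\<lambda>t \<omega>. inner_L2 (\<lambda>u. y u t \<omega>) a) (\<lambda>t \<omega>. inner_L2 (\<lambda>u. y u t \<omega>) a)
           (\<lambda>t \<omega>. enn2ereal (\<integral>\<^sup>+ s\<in>{0..t}.
              ennreal ((norm_L2 (pr_L2 (\<lambda>u. y u s \<omega>) a))\<^sup>2) \<partial>lborel))"
proof -
  interpret prob_space M by fact
  interpret coalescing_flow_L2 M T y a
    using assms by unfold_locales
  have pairing_fun: "pairing = (\<lambda>t \<omega>. inner_L2 (\<lambda>u. y u t \<omega>) a)"
    by (intro ext) (simp add: pairing_def)
  have "joint_qv_eq M (natural_filtration M T y) T pairing pairing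
      (\<lambda>t \<omega>. enn2ereal (\<integral>\<^sup>+ s\<in>{0..t}. ennreal ((norm_L2 (pr_L2 (\<lambda>u. y u s \<omega>) a))\<^sup>2) \<partial>lborel))"
    unfolding joint_qv_eq_def
    by (intro exI[of _ bracket] conjI joint_qv_pairing AE_I2 ballI bracket_eq_integral_norm_pr)
  with cont_sq_int_martingale_pairing show ?thesis unfolding pairing_fun by simp
qed

end
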